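(* Let $G=(V,E)$ be a finite simple graph and let $v\in V$ be a vertex of degree more than three. Suppose that $G-v$ is rigid in $\mathbb{R}^3$, and that there is a generic $\mathbf{p}':V\setminus\{v\}\to\mathbb{R}^3$ such that the framework $(G-v+K(N_G(v)),\mathbf{p}')$ is globally rigid in $\mathbb{R}^3$. Then there is a generic $\mathbf{p}:V\to\mathbb{R}^3$ extending $\mathbf{p}'$ such that $(G,\mathbf{p})$ is globally rigid in $\mathbb{R}^3$.
   Context: A framework $(G,\mathbf{p})$ in $\mathbb{R}^d$ is a graph $G=(V,E)$ with a map $\mathbf{p}:V\to\mathbb{R}^d$, $v\mapsto p_v$. Two frameworks $(G,\mathbf{p}),(G,\mathbf{q})$ are equivalent if $\|p_u-p_v\|=\|q_u-q_v\|$ for all $uv\in E$; $\mathbf{p},\mathbf{q}$ are congruent if this holds for all pairs $u,v\in V$. $(G,\mathbf{p})$ is rigid if there is a neighbourhood $U$ of $\mathbf{p}$ in $\mathbb{R}^{d|V|}$ such that every $\mathbf{q}\in U$ with $(G,\mathbf{q})$ equivalent to $(G,\mathbf{p})$ is congruent to $\mathbf{p}$; it is globally rigid if every $\mathbf{q}\in\mathbb{R}^{d|V|}$ with $(G,\mathbf{q})$ equivalent to $(G,\mathbf{p})$ is congruent to $\mathbf{p}$. $\mathbf{p}$ is generic if its coordinates are algebraically independent over $\mathbb{Q}$. A graph is rigid in $\mathbb{R}^d$ if some (equivalently every) generic realization of it is rigid. $N_G(v)$ is the neighbour set of $v$, and $G-v+K(N_G(v))$ is obtained from $G$ by deleting $v$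 and adding all edges between vertices of $N_G(v)$. *)

theory Defs
  imports "HOL-Analysis.Analysis" "HOL-Library.Poly_Mapping"
begin

text \<open>A graph is a pair of a vertex set \<open>V\<close> and a set \<open>E\<close> of two-element subsets of \<open>V\<close>.\<close>

definition simple_graph :: "'a set \<Rightarrow> 'a set set \<Rightarrow> bool" where
  "simple_graph V E \<longleftrightarrow> finite V \<and> (\<forall>e\<in>E. e \<subseteq> V \<and> card e = 2)"

definition nbrs :: "'a set set \<Rightarrow> 'a \<Rightarrow> 'a set" where
  "nbrs E v = {u. {u, v} \<in> E}"

definition vertex_degree :: "'a set set \<Rightarrow> 'a \<Rightarrow> nat" where
  "vertex_degree E v = card (nbrs E v)"

definition del_vertex_edges :: "'a set set \<Rightarrow> 'a \<Rightarrow> 'a set set" where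
  "del_vertex_edges E v = {e \<in> E. v \<notin> e}"

definition complete_edges :: "'a set \<Rightarrow> 'a set set" where
  "complete_edges X = {{x, y} | x y. x \<in> X \<and> y \<in> X \<and> x \<noteq> y}"

text \<open>
  A realization of a graph with vertex set \<open>V\<close> is a function on the whole vertex type;
  all notions below depend only on its values on \<open>V\<close>.
\<close>

definition equivalent_fw ::
  "'a set set \<Rightarrow> ('a \<Rightarrow> real ^ 'd) \<Rightarrow> ('a \<Rightarrow> real ^ 'd) \<Rightarrow> bool" where
  "equivalent_fw E p q \<longleftrightarrow> (\<forall>u v. {u, v} \<in> E \<longrightarrow> norm (p u - p v) = norm (q u - q v))"

definition congruent_fw ::
  "'a set \<Rightarrow> ('a \<Rightarrow> real ^ 'd) \<Rightarrow> ('a \<Rightarrow> real ^ 'd) \<Rightarrow> bool" where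
  "congruent_fw V p q \<longleftrightarrow> (\<forall>u\<in>V. \<forall>v\<in>V. norm (p u - p v) = norm (q u - q v))"

text \<open>
  The space of realizations is the product of copies of \<open>real ^ 'd\<close> indexed by \<open>V\<close>. Its points
  are the functions that are \<^const>\<open>undefined\<close> outside \<open>V\<close>, hence the \<^const>\<open>restrict\<close>.
\<close>

definition rigid_fw :: "'a set \<Rightarrow> 'a set set \<Rightarrow> ('a \<Rightarrow> real ^ 'd) \<Rightarrow> bool" where
  "rigid_fw V E p \<longleftrightarrow>
     (\<exists>U. openin (product_topology (\<lambda>_. euclidean) V) U \<and> restrict p V \<in> U \<and>
          (\<forall>q\<in>U. equivalent_fw E p q \<longrightarrow> congruent_fw V p q))"

definition globally_rigid_fw :: "'a set \<Rightarrow> 'a set set \<Rightarrow> ('a \<Rightarrow> real ^ 'd) \<Rightarrow> bool" where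
  "globally_rigid_fw V E p \<longleftrightarrow>
     (\<forall>q :: 'a \<Rightarrow> real ^ 'd. equivalent_fw E p q \<longrightarrow> congruent_fw V p q)"

text \<open>
  A polynomial over the rationals in variables of type \<open>'i\<close> is a finitely supported map from
  monomials \<open>'i \<Rightarrow>\<^sub>0 nat\<close> (exponent vectors) to rational coefficients.
\<close>

definition eval_rat_mpoly :: "('i \<Rightarrow> real) \<Rightarrow> (('i \<Rightarrow>\<^sub>0 nat) \<Rightarrow>\<^sub>0 rat) \<Rightarrow> real" where
  "eval_rat_mpoly x P =
     (\<Sum>m\<in>Poly_Mapping.keys P. of_rat (Poly_Mapping.lookup P m) *
        (\<Prod>i\<in>Poly_Mapping.keys m. x i ^ Poly_Mapping.lookup m i))"

text \<open>
  Independence is that of the indexed family \<open>(x i)\<^bsub>i \<in> I\<^esub>\<close>, so equal entries at distinct indices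
  are dependent.
\<close>

definition alg_independent_rat :: "'i set \<Rightarrow> ('i \<Rightarrow> real) \<Rightarrow> bool" where
  "alg_independent_rat I x \<longleftrightarrow>
     (\<forall>P :: ('i \<Rightarrow>\<^sub>0 nat) \<Rightarrow>\<^sub>0 rat.
        (\<forall>m \<in> Poly_Mapping.keys P. Poly_Mapping.keys m \<subseteq> I) \<longrightarrow>
        eval_rat_mpoly x P = 0 \<longrightarrow> P = 0)"

definition generic :: "'a set \<Rightarrow> ('a \<Rightarrow> real ^ 'd) \<Rightarrow> bool" where
  "generic V p \<longleftrightarrow> alg_independent_rat (V \<times> UNIV) (\<lambda>(v, i). p v $ i)"

text \<open>The dimension is passed as the type argument \<open>'d\<close>.\<close>

definition rigid_graph :: "'d::finite itself \<Rightarrow> 'a set \<Rightarrow> 'a set set \<Rightarrow> bool" where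
  "rigid_graph _ V E \<longleftrightarrow> (\<exists>p :: 'a \<Rightarrow> real ^ 'd. generic V p \<and> rigid_fw V E p)"

end

theory Submission
  imports Defs "HOL-Homology.Invariance_of_Domain"
begin

text \<open>
  Rigidity at one generic point forces every squared distance between two vertices of \<open>G - v\<close> to be
  algebraic over the squared edge lengths, and the algebraic relation is a polynomial identity.
  Hence at every generic \<open>p'\<close> the frameworks equivalent to \<open>(G - v, p')\<close> form finitely many
  congruence classes. If such a class is not congruent to \<open>p'\<close> on the neighbours of \<open>v\<close>, then the
  positions \<open>x\<close> of \<open>v\<close> for which some \<open>y\<close> has the same distances to the class as \<open>x\<close> has to \<open>p'\<close>
  are zeros of a nonzero polynomial. By Baire's theorem some \<open>x\<close> avoids these finitely many
  polynomials together with the countably many that express non-genericity. For this \<open>x\<close> an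
  equivalent framework agrees with \<open>p'\<close> on the neighbours of \<open>v\<close> up to congruence, hence on all of
  \<open>G - v\<close> by global rigidity, and \<open>v\<close> is determined by its distances to four affinely independent
  neighbours.
\<close>

subsection \<open>Rational polynomial functions and algebraic independence\<close>

text \<open>\<open>G\<close> lacks the edges of \<open>complete_edges (nbrs E v)\<close>, so an
  equivalent framework may a priori distort the neighbours of \<open>v\<close>, and the global
  rigidity hypothesis says nothing about it. Each possible distortion has to be excluded by the
  position of \<open>v\<close>. This works because the distances from four affinely independent
  neighbours overdetermine a point: after a distortion they fit only on the zero set of a nonzero
  polynomial. Rigidity of \<open>G - v\<close> is a local statement at some generic point, whereas
  finiteness of the classes is a global statement at \<open>p'\<close>. Polynomial identities bridge
  both gaps, since a rational relation at one generic point holds everywhere. Deriving the relation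
  from rigidity takes no derivative of the edge-length map: annihilating polynomials with simple
  roots give local injectivity, and invariance of domain turns injectivity into openness.\<close>

inductive qpoly :: "'i set \<Rightarrow> (('i \<Rightarrow> real) \<Rightarrow> real) \<Rightarrow> bool" for I where
  const: "qpoly I (\<lambda>x. of_rat c)"
| var: "i \<in> I \<Longrightarrow> qpoly I (\<lambda>x. x i)"
| add: "qpoly I f \<Longrightarrow> qpoly I g \<Longrightarrow> qpoly I (\<lambda>x. f x + g x)"
| mult: "qpoly I f \<Longrightarrow> qpoly I g \<Longrightarrow> qpoly I (\<lambda>x. f x * g x)"

lemma qpoly_0: "qpoly I (\<lambda>x. 0)" using qpoly.const[of I 0] by simp

lemma qpoly_1: "qpoly I (\<lambda>x. 1)" using qpoly.const[of I 1] by simp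

lemma qpoly_diff: "qpoly I f \<Longrightarrow> qpoly I g \<Longrightarrow> qpoly I (\<lambda>x. f x - g x)"
  using qpoly.add[OF _ qpoly.mult[OF qpoly.const[of I "-1"]], of f g]
  by (simp add: of_rat_minus)

lemma qpoly_power: "qpoly I f \<Longrightarrow> qpoly I (\<lambda>x. f x ^ n)"
  by (induction n) (auto intro: qpoly_1 qpoly.mult)

lemma qpoly_sum: "(\<And>a. a \<in> S \<Longrightarrow> qpoly I (f a)) \<Longrightarrow> qpoly I (\<lambda>x. \<Sum>a\<in>S. f a x)"
  by (induction S rule: infinite_finite_induct) (auto intro: qpoly_0 qpoly.add)

lemma qpoly_prod: "(\<And>a. a \<in> S \<Longrightarrow> qpoly I (f a)) \<Longrightarrow> qpoly I (\<lambda>x. \<Prod>a\<in>S. f a x)"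
  by (induction S rule: infinite_finite_induct) (auto intro: qpoly_1 qpoly.mult)

lemma qpoly_mono: "qpoly I f \<Longrightarrow> I \<subseteq> J \<Longrightarrow> qpoly J f"
  by (induction rule: qpoly.induct) (auto intro: qpoly.intros)

lemma qpoly_cong: "qpoly I f \<Longrightarrow> (\<And>i. i \<in> I \<Longrightarrow> x i = y i) \<Longrightarrow> f x = f y"
  by (induction rule: qpoly.induct) auto

lemma qpoly_compose:
  "qpoly J g \<Longrightarrow> (\<And>j. j \<in> J \<Longrightarrow> qpoly I (c j)) \<Longrightarrow> qpoly I (\<lambda>x. g (\<lambda>j. c j x))"
  by (induction rule: qpoly.induct) (auto intro: qpoly.intros)

lemma continuous_on_qpoly: "qpoly I f \<Longrightarrow> continuous_on UNIV f"
  by (induction rule: qpoly.induct) (auto intro: continuous_intros continuous_on_product_coordinates)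

section \<open>Formal polynomials and their evaluation\<close>

definition monom_val :: "('i \<Rightarrow> real) \<Rightarrow> ('i \<Rightarrow>\<^sub>0 nat) \<Rightarrow> real" where
  "monom_val x m = (\<Prod>i\<in>Poly_Mapping.keys m. x i ^ Poly_Mapping.lookup m i)"

lemma monom_val_superset:
  "finite S \<Longrightarrow> Poly_Mapping.keys m \<subseteq> S \<Longrightarrow>
    monom_val x m = (\<Prod>i\<in>S. x i ^ Poly_Mapping.lookup m i)"
  unfolding monom_val_def by (intro prod.mono_neutral_left) (auto simp: in_keys_iff)

lemma monom_val_add: "monom_val x (m + n) = monom_val x m * monom_val x n"
proof -
  let ?S = "Poly_Mapping.keys m \<union> Poly_Mapping.keys n"
  have "monom_val x (m + n) = (\<Prod>i\<in>?S. x i ^ Poly_Mapping.lookup (m + n) i)"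
    by (rule monom_val_superset) (auto dest: subsetD[OF Poly_Mapping.keys_add])
  then show ?thesis
    by (simp add: lookup_add power_add prod.distrib monom_val_superset[of ?S m] monom_val_superset[of ?S n])
qed

lemma eval_rat_mpoly_superset:
  "finite S \<Longrightarrow> Poly_Mapping.keys P \<subseteq> S \<Longrightarrow>
    eval_rat_mpoly x P = (\<Sum>m\<in>S. of_rat (Poly_Mapping.lookup P m) * monom_val x m)"
  unfolding eval_rat_mpoly_def monom_val_def
  by (intro sum.mono_neutral_left) (auto simp: in_keys_iff)

lemma eval_rat_mpoly_add: "eval_rat_mpoly x (P + Q) = eval_rat_mpoly x P + eval_rat_mpoly x Q"
proof -
  let ?S = "Poly_Mapping.keys P \<union> Poly_Mapping.keys Q"
  have "eval_rat_mpoly x (P + Q) = (\<Sum>m\<in>?S. of_rat (Poly_Mapping.lookup (P + Q) m) * monom_val x m)"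
    by (rule eval_rat_mpoly_superset) (auto dest: subsetD[OF Poly_Mapping.keys_add])
  then show ?thesis
    by (simp add: lookup_add of_rat_add distrib_right sum.distrib
        eval_rat_mpoly_superset[of ?S P] eval_rat_mpoly_superset[of ?S Q])
qed

lemma eval_rat_mpoly_0: "eval_rat_mpoly x 0 = 0"
  by (simp add: eval_rat_mpoly_def)

lemma eval_rat_mpoly_single: "eval_rat_mpoly x (Poly_Mapping.single m c) = of_rat c * monom_val x m"
  by (simp add: eval_rat_mpoly_def monom_val_def)

lemma poly_mapping_induct [case_names single sum]:
  fixes P :: "('k \<Rightarrow>\<^sub>0 'v::comm_monoid_add) \<Rightarrow> bool"
  assumes "\<And>k v. P (Poly_Mapping.single k v)" "\<And>f g. P f \<Longrightarrow> P g \<Longrightarrow> P (f + g)"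
  shows "P f"
proof (induction f rule: update_induct)
  case const
  show ?case using assms(1)[of undefined 0] by simp
next
  case (update f k v)
  have "Poly_Mapping.update k v f = Poly_Mapping.single k v + f"
    using update(1)
    by (intro poly_mapping_eqI) (auto simp: lookup_update lookup_add lookup_single in_keys_iff when_def)
  with update(3) show ?case using assms by simp
qed

lemma eval_rat_mpoly_mult: "eval_rat_mpoly x (P * Q) = eval_rat_mpoly x P * eval_rat_mpoly x Q"
proof -
  have mult_single_left: "eval_rat_mpoly x (Poly_Mapping.single m c * Q) = of_rat c * monom_val x m * eval_rat_mpoly x Q"
    for m c Q
  proof (induction Q rule: poly_mapping_induct)
    case (single k v)
    then show ?case
      by (simp add: mult_single eval_rat_mpoly_single monom_val_add of_rat_mult)
  next
    case (sum Q1 Q2)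
    then show ?case by (simp add: eval_rat_mpoly_add algebra_simps)
  qed
  show ?thesis
  proof (induction P rule: poly_mapping_induct)
    case (single k v)
    then show ?case by (simp add: mult_single_left eval_rat_mpoly_single)
  next
    case (sum P1 P2)
    then show ?case by (simp add: eval_rat_mpoly_add algebra_simps)
  qed
qed

lemma qpoly_imp_eval:
  "qpoly I f \<Longrightarrow> \<exists>P. (\<forall>m\<in>Poly_Mapping.keys P. Poly_Mapping.keys m \<subseteq> I) \<and> (\<forall>x. f x = eval_rat_mpoly x P)"
proof (induction rule: qpoly.induct)
  case (const c)
  show ?case
    by (rule exI[of _ "Poly_Mapping.single 0 c"]) (simp add: eval_rat_mpoly_single monom_val_def)
next
  case (var i)
  then show ?case
    by (intro exI[of _ "Poly_Mapping.single (Poly_Mapping.single i 1) 1"])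
      (simp add: eval_rat_mpoly_single monom_val_def)
next
  case (add f g)
  then obtain P Q where "\<forall>m\<in>Poly_Mapping.keys P. Poly_Mapping.keys m \<subseteq> I" "\<forall>x. f x = eval_rat_mpoly x P"
    "\<forall>m\<in>Poly_Mapping.keys Q. Poly_Mapping.keys m \<subseteq> I" "\<forall>x. g x = eval_rat_mpoly x Q" by auto
  then show ?case
    by (intro exI[of _ "P + Q"]) (auto simp: eval_rat_mpoly_add dest!: subsetD[OF Poly_Mapping.keys_add])
next
  case (mult f g)
  then obtain P Q where *: "\<forall>m\<in>Poly_Mapping.keys P. Poly_Mapping.keys m \<subseteq> I" "\<forall>x. f x = eval_rat_mpoly x P"
    "\<forall>m\<in>Poly_Mapping.keys Q. Poly_Mapping.keys m \<subseteq> I" "\<forall>x. g x = eval_rat_mpoly x Q" by auto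
  have "Poly_Mapping.keys m \<subseteq> I" if m: "m \<in> Poly_Mapping.keys (P * Q)" for m
  proof -
    obtain a b where "m = a + b" "a \<in> Poly_Mapping.keys P" "b \<in> Poly_Mapping.keys Q"
      using subsetD[OF Poly_Mapping.keys_mult m] by auto
    then show ?thesis using *(1,3) Poly_Mapping.keys_add[of a b] by blast
  qed
  with * show ?case
    by (intro exI[of _ "P * Q"]) (auto simp: eval_rat_mpoly_mult)
qed

lemma qpoly_eval:
  "(\<And>m. m \<in> Poly_Mapping.keys P \<Longrightarrow> Poly_Mapping.keys m \<subseteq> I) \<Longrightarrow> qpoly I (\<lambda>x. eval_rat_mpoly x P)"
  unfolding eval_rat_mpoly_def
  by (intro qpoly_sum qpoly.mult qpoly.const qpoly_prod qpoly_power qpoly.var) auto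

lemma base_digits_inj:
  fixes f g :: "nat \<Rightarrow> nat"
  assumes "\<And>i. i < n \<Longrightarrow> f i < b" "\<And>i. i < n \<Longrightarrow> g i < b"
    and "(\<Sum>i<n. f i * b ^ i) = (\<Sum>i<n. g i * b ^ i)" "i < n"
  shows "f i = g i"
  using assms
proof (induction n arbitrary: f g i)
  case (Suc n)
  have split: "(\<Sum>i<Suc n. h i * b ^ i) = h 0 + b * (\<Sum>i<n. h (Suc i) * b ^ i)" for h :: "nat \<Rightarrow> nat"
    by (subst sum.lessThan_Suc_shift) (simp add: sum_distrib_left mult_ac)
  have eq: "f 0 + b * (\<Sum>i<n. f (Suc i) * b ^ i) = g 0 + b * (\<Sum>i<n. g (Suc i) * b ^ i)"
    using Suc.prems(3) by (simp only: split)
  have "f 0 < b" "g 0 < b" using Suc.prems(1,2)[of 0] by auto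
  then have 0: "f 0 = g 0"
    using arg_cong[OF eq, of "\<lambda>k. k mod b"] by simp
  then have "(\<Sum>i<n. f (Suc i) * b ^ i) = (\<Sum>i<n. g (Suc i) * b ^ i)"
    using eq \<open>f 0 < b\<close> by simp
  then have "f (Suc j) = g (Suc j)" if "j < n" for j
    using Suc.IH[of "\<lambda>i. f (Suc i)" "\<lambda>i. g (Suc i)" j] Suc.prems(1,2) that by auto
  then show ?case using 0 Suc.prems(4) by (cases i) auto
qed simp

text \<open>Kronecker substitution: \<open>x i = t ^ b ^ h i\<close> sends distinct monomials to distinct powers of \<open>t\<close>.\<close>

lemma poly_function_eq_0_imp_coeff_0:
  fixes c :: "('i \<Rightarrow> nat) \<Rightarrow> real"
  assumes I: "finite I" and M: "finite M"
    and inj: "\<And>m m'. m \<in> M \<Longrightarrow> m' \<in> M \<Longrightarrow> (\<And>i. i \<in> I \<Longrightarrow> m i = m' i) \<Longrightarrow> m = m'"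
    and zero: "\<And>x. (\<Sum>m\<in>M. c m * (\<Prod>i\<in>I. x i ^ m i)) = 0"
    and "m0 \<in> M"
  shows "c m0 = 0"
proof -
  obtain h where h: "bij_betw h {..<card I} I"
    using ex_bij_betw_nat_finite[OF I] by (auto simp: atLeast0LessThan)
  define h' where "h' = inv_into {..<card I} h"
  have h': "h' (h k) = k" if "k < card I" for k
    using h that by (simp add: h'_def bij_betw_def)
  \<comment> \<open>One more than the sum of all exponents, so that every exponent is a digit in
    base \<open>b\<close>.\<close>
  define b where "b = Suc (\<Sum>m\<in>M. \<Sum>i\<in>I. m i)"
  have lt: "m i < b" if "m \<in> M" "i \<in> I" for m i
  proof -
    have "m i \<le> (\<Sum>i\<in>I. m i)" using that I by (intro member_le_sum) auto
    also have "\<dots> \<le> (\<Sum>m\<in>M. \<Sum>i\<in>I. m i)" using that M by (intro member_le_sum) auto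
    finally show ?thesis by (simp add: b_def)
  qed
  define \<phi> where "\<phi> m = (\<Sum>k<card I. m (h k) * b ^ k)" for m :: "'i \<Rightarrow> nat"
  have inj\<phi>: "m = m'" if "m \<in> M" "m' \<in> M" "\<phi> m = \<phi> m'" for m m'
  proof (rule inj[OF that(1,2)])
    have hk: "h k \<in> I" if "k < card I" for k using h that by (auto simp: bij_betw_def)
    have "m (h k) = m' (h k)" if "k < card I" for k
      by (rule base_digits_inj[of "card I" "\<lambda>k. m (h k)" b "\<lambda>k. m' (h k)"])
        (use \<open>m \<in> M\<close> \<open>m' \<in> M\<close> \<open>\<phi> m = \<phi> m'\<close> lt hk that in \<open>auto simp: \<phi>_def\<close>)
    then show "m i = m' i" if "i \<in> I" for i
      using h that by (force simp: bij_betw_def)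
  qed
  define p where "p = (\<Sum>m\<in>M. Polynomial.monom (c m) (\<phi> m))"
  have "poly p t = 0" for t
  proof -
    have "(\<Prod>i\<in>I. (t ^ (b ^ h' i)) ^ m i) = t ^ \<phi> m" for m
    proof -
      have "(\<Prod>i\<in>I. (t ^ (b ^ h' i)) ^ m i) = (\<Prod>k<card I. (t ^ (b ^ h' (h k))) ^ m (h k))"
        by (rule prod.reindex_bij_betw[OF h, symmetric])
      also have "\<dots> = (\<Prod>k<card I. t ^ (m (h k) * b ^ k))"
        by (intro prod.cong) (auto simp: h' power_mult[symmetric] mult.commute)
      finally show ?thesis by (simp add: \<phi>_def power_sum)
    qed
    with zero[of "\<lambda>i. t ^ (b ^ h' i)"] show ?thesis
      by (simp add: p_def poly_sum poly_monom)
  qed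
  then have "p = 0" using poly_all_0_iff_0 by blast
  moreover have "Polynomial.coeff p (\<phi> m0) = c m0"
  proof -
    have "Polynomial.coeff p (\<phi> m0) = (\<Sum>m\<in>M. if m = m0 then c m else 0)"
      using inj\<phi> \<open>m0 \<in> M\<close> by (auto simp: p_def coeff_sum intro!: sum.cong)
    then show ?thesis using M \<open>m0 \<in> M\<close> by simp
  qed
  ultimately show ?thesis by simp
qed

lemma eval_rat_mpoly_eq_0_imp:
  assumes "\<And>x. eval_rat_mpoly x P = 0"
  shows "P = 0"
proof (rule poly_mapping_eqI)
  fix m0
  let ?K = "Poly_Mapping.keys P"
  let ?I = "\<Union>m\<in>?K. Poly_Mapping.keys m"
  show "Poly_Mapping.lookup P m0 = Poly_Mapping.lookup 0 m0"
  proof (cases "m0 \<in> ?K")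
    case True
    have inj: "inj_on Poly_Mapping.lookup ?K"
      by (intro inj_onI poly_mapping_eqI) simp
    let ?c = "\<lambda>m. real_of_rat (Poly_Mapping.lookup P (Abs_poly_mapping m))"
    have "?c (Poly_Mapping.lookup m0) = 0"
    proof (rule poly_function_eq_0_imp_coeff_0[of ?I "Poly_Mapping.lookup ` ?K" ?c])
      show "(\<Sum>m\<in>Poly_Mapping.lookup ` ?K. ?c m * (\<Prod>i\<in>?I. x i ^ m i)) = 0" for x
      proof -
        have "(\<Sum>m\<in>Poly_Mapping.lookup ` ?K. ?c m * (\<Prod>i\<in>?I. x i ^ m i))
          = (\<Sum>m\<in>?K. of_rat (Poly_Mapping.lookup P m) * (\<Prod>i\<in>?I. x i ^ Poly_Mapping.lookup m i))"
          by (simp add: sum.reindex[OF inj])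
        also have "\<dots> = (\<Sum>m\<in>?K. of_rat (Poly_Mapping.lookup P m) * monom_val x m)"
          by (intro sum.cong refl arg_cong2[where f = "(*)"] monom_val_superset[symmetric]) auto
        also have "\<dots> = 0" using assms[of x] by (simp add: eval_rat_mpoly_def monom_val_def)
        finally show ?thesis .
      qed
      fix m m' assume "m \<in> Poly_Mapping.lookup ` ?K" "m' \<in> Poly_Mapping.lookup ` ?K"
        and eq: "\<And>i. i \<in> ?I \<Longrightarrow> m i = m' i"
      then obtain k k' where k: "k \<in> ?K" "k' \<in> ?K" "m = Poly_Mapping.lookup k" "m' = Poly_Mapping.lookup k'"
        by auto
      have "m i = m' i" if "i \<notin> ?I" for i
        using that k by (auto simp: in_keys_iff)
      with eq show "m = m'" by blast
    qed (use True in auto)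
    then show ?thesis by simp
  qed (simp add: in_keys_iff)
qed

text \<open>Independence in terms of functions instead of formal polynomials; the two agree because
  a formal polynomial that vanishes at all real points is zero. This form is a transfer principle: a
  relation that holds at \<open>y\<close> holds at every point.\<close>

definition alg_indep :: "'i set \<Rightarrow> ('i \<Rightarrow> real) \<Rightarrow> bool" where
  "alg_indep I y \<longleftrightarrow> (\<forall>f. qpoly I f \<longrightarrow> f y = 0 \<longrightarrow> (\<forall>x. f x = 0))"

lemma alg_independent_rat_iff: "alg_independent_rat I y \<longleftrightarrow> alg_indep I y"
proof
  assume L: "alg_independent_rat I y"
  show "alg_indep I y"
    unfolding alg_indep_def
  proof (intro allI impI)
    fix f x assume "qpoly I f" "f y = 0"
    then obtain P where "\<forall>m\<in>Poly_Mapping.keys P. Poly_Mapping.keys m \<subseteq> I" "\<forall>x. f x = eval_rat_mpoly x P"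
      using qpoly_imp_eval by blast
    with L \<open>f y = 0\<close> have "P = 0" unfolding alg_independent_rat_def by metis
    then show "f x = 0" using \<open>\<forall>x. f x = eval_rat_mpoly x P\<close> by (simp add: eval_rat_mpoly_0)
  qed
next
  assume R: "alg_indep I y"
  show "alg_independent_rat I y"
    unfolding alg_independent_rat_def
  proof (intro allI impI)
    fix P assume "\<forall>m\<in>Poly_Mapping.keys P. Poly_Mapping.keys m \<subseteq> I" "eval_rat_mpoly y P = 0"
    then have "\<forall>x. eval_rat_mpoly x P = 0"
      using R qpoly_eval[of P I] unfolding alg_indep_def by blast
    then show "P = 0" by (intro eval_rat_mpoly_eq_0_imp) blast
  qed
qed

lemma alg_indepD: "alg_indep I y \<Longrightarrow> qpoly I f \<Longrightarrow> f y = 0 \<Longrightarrow> f x = 0"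
  unfolding alg_indep_def by blast

subsection \<open>Algebraic elements\<close>

text \<open>A univariate polynomial whose coefficients are rational polynomial functions of
  parameters. The degree bound is uniform so that evaluation is a sum of fixed length, hence again a
  \<open>qpoly\<close>.\<close>

definition qpoly_family :: "'j set \<Rightarrow> (('j \<Rightarrow> real) \<Rightarrow> real poly) \<Rightarrow> bool" where
  "qpoly_family J A \<longleftrightarrow> (\<forall>k. qpoly J (\<lambda>y. Polynomial.coeff (A y) k)) \<and> (\<exists>n. \<forall>y. degree (A y) \<le> n)"

definition algebraic_over :: "'j set \<Rightarrow> ('j \<Rightarrow> real) \<Rightarrow> real \<Rightarrow> bool" where
  "algebraic_over J y t \<longleftrightarrow> (\<exists>A. qpoly_family J A \<and> A y \<noteq> 0 \<and> poly (A y) t = 0)"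

lemma algebraic_over_mono: "algebraic_over J y t \<Longrightarrow> J \<subseteq> K \<Longrightarrow> algebraic_over K y t"
  unfolding algebraic_over_def qpoly_family_def by (meson qpoly_mono)

lemma algebraic_over_member: "j \<in> J \<Longrightarrow> algebraic_over J y (y j)"
  unfolding algebraic_over_def
proof (intro exI conjI)
  assume "j \<in> J"
  have "qpoly J (\<lambda>y. Polynomial.coeff [:- y j, 1:] k)" for k
    using qpoly_diff[OF qpoly_0 qpoly.var[OF \<open>j \<in> J\<close>]]
    by (cases k) (auto simp: coeff_pCons split: nat.split intro: qpoly_0 qpoly_1)
  then show "qpoly_family J (\<lambda>y. [:- y j, 1:])"
    by (auto simp: qpoly_family_def intro!: exI[of _ 1])
qed auto

lemma qpoly_as_poly:
  assumes "qpoly (insert i I) f" "i \<notin> I"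
  shows "\<exists>A. qpoly_family I A \<and> (\<forall>x t. f (x(i := t)) = poly (A x) t)"
  using assms(1)
proof (induction rule: qpoly.induct)
  case (const c)
  have "qpoly I (\<lambda>x. Polynomial.coeff [:real_of_rat c:] k)" for k
    by (cases k) (auto intro: qpoly.const qpoly_0)
  then show ?case
    by (intro exI[of _ "\<lambda>x. [:of_rat c:]"]) (auto simp: qpoly_family_def)
next
  case (var j)
  show ?case
  proof (cases "j = i")
    case True
    have "qpoly I (\<lambda>x. Polynomial.coeff [:0, 1:] k)" for k
      by (cases k) (auto simp: coeff_pCons split: nat.split intro: qpoly_0 qpoly_1)
    then show ?thesis using True
      by (intro exI[of _ "\<lambda>x. [:0, 1:]"]) (auto simp: qpoly_family_def intro!: exI[of _ 1])
  next
    case False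
    then have "j \<in> I" using var by auto
    then have "qpoly I (\<lambda>x. Polynomial.coeff [:x j:] k)" for k
      by (cases k) (auto intro: qpoly_0 qpoly.var)
    then show ?thesis using False
      by (intro exI[of _ "\<lambda>x. [:x j:]"]) (auto simp: qpoly_family_def)
  qed
next
  case (add f g)
  then obtain A B where AB: "qpoly_family I A" "\<forall>x t. f (x(i := t)) = poly (A x) t"
    "qpoly_family I B" "\<forall>x t. g (x(i := t)) = poly (B x) t" by blast
  then obtain n m where "\<forall>x. degree (A x) \<le> n" "\<forall>x. degree (B x) \<le> m"
    unfolding qpoly_family_def by blast
  then have "\<forall>x. degree (A x + B x) \<le> max n m"
    by (metis degree_add_le max.coboundedI1 max.coboundedI2)
  moreover have "qpoly I (\<lambda>x. Polynomial.coeff (A x + B x) k)" for k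
    using AB by (simp add: qpoly.add qpoly_family_def)
  ultimately show ?case using AB
    by (intro exI[of _ "\<lambda>x. A x + B x"]) (auto simp: qpoly_family_def simp del: fun_upd_apply)
next
  case (mult f g)
  then obtain A B where AB: "qpoly_family I A" "\<forall>x t. f (x(i := t)) = poly (A x) t"
    "qpoly_family I B" "\<forall>x t. g (x(i := t)) = poly (B x) t" by blast
  have "qpoly I (\<lambda>x. Polynomial.coeff (A x * B x) k)" for k
    using AB unfolding coeff_mult qpoly_family_def by (intro qpoly_sum qpoly.mult) auto
  moreover obtain n m where "\<forall>x. degree (A x) \<le> n" "\<forall>x. degree (B x) \<le> m"
    using AB unfolding qpoly_family_def by blast
  then have "\<forall>x. degree (A x * B x) \<le> n + m"
    by (meson add_mono degree_mult_le order_trans)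
  ultimately show ?case using AB
    by (intro exI[of _ "\<lambda>x. A x * B x"]) (auto simp: qpoly_family_def simp del: fun_upd_apply)
qed

text \<open>A relation that involves \<open>i\<close>, read as a polynomial in that variable,
  annihilates \<open>y i\<close>. If all its coefficients vanished at \<open>y\<close>, independence
  of \<open>J\<close> would make them vanish identically, and the relation would be trivial.\<close>

lemma algebraic_over_if_dependent:
  assumes "alg_indep J y" "\<not> alg_indep (insert i J) y"
  shows "algebraic_over J y (y i)"
proof -
  have "i \<notin> J" using assms by (auto simp: insert_absorb)
  obtain f x where f: "qpoly (insert i J) f" "f y = 0" "f x \<noteq> 0"
    using assms(2) unfolding alg_indep_def by blast
  obtain A where A: "qpoly_family J A" "\<And>x t. f (x(i := t)) = poly (A x) t"
    using qpoly_as_poly[OF f(1) \<open>i \<notin> J\<close>] by blast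
  have fA: "f x = poly (A x) (x i)" for x
    using A(2)[of x "x i"] by simp
  have "A y \<noteq> 0"
  proof
    assume "A y = 0"
    then have "Polynomial.coeff (A x) k = 0" for k
      using alg_indepD[OF assms(1), of "\<lambda>x. Polynomial.coeff (A x) k"] A(1) by (auto simp: qpoly_family_def)
    then have "A x = 0" by (intro poly_eqI) simp
    with fA f(3) show False by simp
  qed
  then show ?thesis
    using A(1) fA[of y] f(2) unfolding algebraic_over_def by auto
qed

section \<open>Simple roots and local determination\<close>

lemma qpoly_family_pderiv:
  assumes "qpoly_family J A"
  shows "qpoly_family J (\<lambda>y. pderiv (A y))"
proof -
  obtain n where "\<And>y. degree (A y) \<le> n" using assms by (auto simp: qpoly_family_def)
  then have "\<forall>y. degree (pderiv (A y)) \<le> n"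
    by (metis degree_pderiv diff_le_self order_trans)
  moreover have "qpoly J (\<lambda>y. Polynomial.coeff (pderiv (A y)) k)" for k
    using qpoly.mult[OF qpoly.const[of J "of_nat (Suc k)"], of "\<lambda>y. Polynomial.coeff (A y) (Suc k)"] assms
    by (simp add: coeff_pderiv qpoly_family_def del: of_nat_Suc)
  ultimately show ?thesis unfolding qpoly_family_def by blast
qed

text \<open>Among the annihilating polynomials take one of least degree at \<open>y\<close>. Its
  derivative is nonzero and has smaller degree, so it cannot vanish at \<open>t\<close>.\<close>

lemma algebraic_over_simple_root:
  assumes "algebraic_over J y t"
  shows "\<exists>A. qpoly_family J A \<and> poly (A y) t = 0 \<and> poly (pderiv (A y)) t \<noteq> 0"
proof -
  let ?P = "\<lambda>A. qpoly_family J A \<and> A y \<noteq> 0 \<and> poly (A y) t = 0"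
  obtain A where A: "?P A" and min: "\<And>B. ?P B \<Longrightarrow> degree (A y) \<le> degree (B y)"
    using ex_has_least_nat[of ?P _ "\<lambda>A. degree (A y)"] assms unfolding algebraic_over_def by blast
  have deg: "degree (A y) \<noteq> 0"
  proof
    assume "degree (A y) = 0"
    then obtain c where "A y = [:c:]" by (rule degree_eq_zeroE)
    with A show False by simp
  qed
  then have "pderiv (A y) \<noteq> 0" by (simp add: pderiv_eq_0_iff)
  then have "poly (pderiv (A y)) t \<noteq> 0"
    using min[of "\<lambda>y. pderiv (A y)"] A deg qpoly_family_pderiv[of J A]
    by (auto simp: degree_pderiv)
  with A show ?thesis by blast
qed

lemma poly_as_sum_le: "degree p \<le> n \<Longrightarrow> poly p x = (\<Sum>k\<le>n. Polynomial.coeff p k * x ^ k)"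
  for p :: "real poly"
  unfolding poly_altdef by (intro sum.mono_neutral_left) (auto simp: coeff_eq_0)

text \<open>
  From here on, algebraic independence is also applied to sets \<open>C\<close> of functions: the index of a
  value is the function itself, so the family of values at \<open>x\<close> is \<open>\<lambda>f. f x\<close>.
\<close>

lemma qpoly_poly_family:
  assumes "qpoly_family C A" "\<And>f. f \<in> C \<Longrightarrow> qpoly I f" "qpoly I h"
  shows "qpoly I (\<lambda>x. poly (A (\<lambda>f. f x)) (h x))"
proof -
  obtain n where n: "\<And>y. degree (A y) \<le> n" using assms(1) by (auto simp: qpoly_family_def)
  have "qpoly I (\<lambda>x. Polynomial.coeff (A (\<lambda>f. f x)) k)" for k
    by (rule qpoly_compose[of C "\<lambda>y. Polynomial.coeff (A y) k" I "\<lambda>f. f"])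
      (use assms(1,2) in \<open>auto simp: qpoly_family_def\<close>)
  then show ?thesis
    unfolding poly_as_sum_le[OF n] by (intro qpoly_sum qpoly.mult qpoly_power assms(3))
qed

text \<open>The annihilating relation holds at all points by independence. Near \<open>x0\<close>
  the derivative does not vanish, so by the mean value theorem the polynomial has at most one root
  close to \<open>h x0\<close>; as its coefficients depend only on the values of \<open>C\<close>,
  these values fix \<open>h\<close>.\<close>

lemma locally_determined:
  fixes C :: "(('i \<Rightarrow> real) \<Rightarrow> real) set"
  assumes indep: "alg_indep I x0" and C: "\<And>f. f \<in> C \<Longrightarrow> qpoly I f" and h: "qpoly I h"
    and alg: "algebraic_over C (\<lambda>f. f x0) (h x0)"
  shows "\<exists>W. open W \<and> x0 \<in> W \<and> (\<forall>x\<in>W. \<forall>x'\<in>W. (\<forall>f\<in>C. f x = f x') \<longrightarrow> h x = h x')"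
proof -
  obtain A where A: "qpoly_family C A" "poly (A (\<lambda>f. f x0)) (h x0) = 0"
    "poly (pderiv (A (\<lambda>f. f x0))) (h x0) \<noteq> 0"
    using algebraic_over_simple_root[OF alg] by blast
  have root: "poly (A (\<lambda>f. f x)) (h x) = 0" for x
    using alg_indepD[OF indep qpoly_poly_family[OF A(1) C h]] A(2) by blast
  have dA: "qpoly_family C (\<lambda>y. pderiv (A y))" using A(1) by (rule qpoly_family_pderiv)
  then obtain n where n: "\<And>y. degree (pderiv (A y)) \<le> n" by (auto simp: qpoly_family_def)
  define D where "D = (\<lambda>(x, s). poly (pderiv (A (\<lambda>f. f x))) s)"
  have "continuous_on UNIV (\<lambda>x. Polynomial.coeff (pderiv (A (\<lambda>f. f x))) k)" for k
    by (intro continuous_on_qpoly[of I] qpoly_compose[of C "\<lambda>y. Polynomial.coeff (pderiv (A y)) k" I "\<lambda>f. f"])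
      (use dA C in \<open>auto simp: qpoly_family_def\<close>)
  then have "continuous_on UNIV (\<lambda>p::('i \<Rightarrow> real) \<times> real. Polynomial.coeff (pderiv (A (\<lambda>f. f (fst p)))) k)" for k
    by (rule continuous_on_compose2) (auto intro: continuous_on_fst continuous_on_id)
  then have "continuous_on UNIV D"
    unfolding D_def case_prod_beta poly_as_sum_le[OF n]
    by (intro continuous_on_sum continuous_on_mult continuous_on_power continuous_on_snd
        continuous_on_id)
  then have "open {p. D p \<noteq> 0}"
    using open_Collect_neq[of D "\<lambda>_. 0"] by simp
  moreover have "(x0, h x0) \<in> {p. D p \<noteq> 0}" using A(3) by (simp add: D_def)
  ultimately obtain S T where S: "open S" "x0 \<in> S" and T: "open T" "h x0 \<in> T" and ST: "S \<times> T \<subseteq> {p. D p \<noteq> 0}"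
    by (auto elim: open_prod_elim)
  obtain e where e: "e > 0" "ball (h x0) e \<subseteq> T" using T openE by blast
  define W where "W = S \<inter> h -` ball (h x0) e"
  have "open W" unfolding W_def
    using continuous_on_qpoly[OF h] S by (intro open_Int open_vimage) auto
  moreover have "x0 \<in> W" using S e by (simp add: W_def)
  moreover have "h x = h x'" if x: "x \<in> W" and x': "x' \<in> W" and eq: "\<And>f. f \<in> C \<Longrightarrow> f x = f x'" for x x'
  proof -
    have same: "A (\<lambda>f. f x') = A (\<lambda>f. f x)"
    proof (rule poly_eqI)
      fix k
      have "qpoly C (\<lambda>y. Polynomial.coeff (A y) k)" using A(1) by (simp add: qpoly_family_def)
      then show "Polynomial.coeff (A (\<lambda>f. f x')) k = Polynomial.coeff (A (\<lambda>f. f x)) k"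
        by (rule qpoly_cong) (rule eq[symmetric])
    qed
    have "\<not> a < b" if a: "a \<in> ball (h x0) e" "poly (A (\<lambda>f. f x)) a = 0"
      and b: "b \<in> ball (h x0) e" "poly (A (\<lambda>f. f x)) b = 0" for a b
    proof
      assume "a < b"
      then obtain s where s: "a < s" "s < b" "poly (pderiv (A (\<lambda>f. f x))) s = 0"
        using poly_MVT[of a b "A (\<lambda>f. f x)"] a(2) b(2) by auto
      have "s \<in> ball (h x0) e"
        using s(1,2) a(1) b(1) by (auto simp: dist_real_def)
      then have "(x, s) \<in> S \<times> T" using e(2) x by (auto simp: W_def)
      then have "D (x, s) \<noteq> 0" using ST by blast
      with s(3) show False by (simp add: D_def)
    qed
    from this[of "h x" "h x'"] this[of "h x'" "h x"] x x' root[of x] root[of x'] same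
    show ?thesis by (auto simp: W_def not_less)
  qed
  ultimately show ?thesis by blast
qed

text \<open>
  Counting: over the rationals, the monomials of degree at most \<open>k\<close> in each \<open>y j\<close> are linearly
  independent, but they lie in the span of the monomials in \<open>x\<close> of degree \<open>O(k)\<close>.
\<close>

lemma alg_indep_card_le:
  fixes y :: "'j \<Rightarrow> real"
  assumes I: "finite I" and C: "finite C" and indep: "alg_indep C y"
    and y: "\<And>j. j \<in> C \<Longrightarrow> \<exists>f. qpoly I f \<and> y j = f x"
  shows "card C \<le> card I"
proof (rule ccontr)
  assume less: "\<not> card C \<le> card I"
  interpret V: vector_space "\<lambda>(r::rat) (t::real). of_rat r * t"
    by unfold_locales (auto simp: of_rat_add of_rat_mult algebra_simps)
  define M where "M D = (\<lambda>m. \<Prod>i\<in>I. x i ^ m i) ` (I \<rightarrow>\<^sub>E {..D})" for D :: nat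
  have M_I: "(\<Prod>i\<in>I. x i ^ m i) \<in> M D" if "\<And>i. i \<in> I \<Longrightarrow> m i \<le> D" for m D
    unfolding M_def using that
    by (intro image_eqI[of _ _ "restrict m I"]) (auto intro!: prod.cong)
  have finM: "finite (M D)" for D
    unfolding M_def by (intro finite_imageI finite_PiE I) auto
  have cardM: "card (M D) \<le> Suc D ^ card I" for D
  proof -
    have "card (M D) \<le> card (I \<rightarrow>\<^sub>E {..D})"
      unfolding M_def by (intro card_image_le finite_PiE I) auto
    then show ?thesis using I by (simp add: card_PiE)
  qed
  have M_mono: "V.span (M D) \<subseteq> V.span (M D')" if "D \<le> D'" for D D'
    unfolding M_def using that by (intro V.span_mono image_mono PiE_mono) auto
  have M_mult: "a * b \<in> M (D + D')" if "a \<in> M D" "b \<in> M D'" for a b D D'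
  proof -
    obtain m m' where m: "m \<in> I \<rightarrow>\<^sub>E {..D}" "m' \<in> I \<rightarrow>\<^sub>E {..D'}"
      and ab: "a = (\<Prod>i\<in>I. x i ^ m i)" "b = (\<Prod>i\<in>I. x i ^ m' i)"
      using \<open>a \<in> M D\<close> \<open>b \<in> M D'\<close> by (auto simp: M_def)
    have "a * b = (\<Prod>i\<in>I. x i ^ (m i + m' i))"
      by (simp add: ab power_add prod.distrib)
    moreover have "m i + m' i \<le> D + D'" if "i \<in> I" for i
      using m that by (intro add_mono) (auto dest: PiE_mem)
    ultimately show ?thesis using M_I by simp
  qed
  have mult1: "a * b \<in> V.span (M (D + D'))" if "a \<in> V.span (M D)" "b \<in> M D'" for a b D D'
    using that(1)
  proof (induction rule: V.span_induct_alt)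
    case base
    show ?case using V.span_zero by simp
  next
    case (step c u w)
    have "u * b \<in> V.span (M (D + D'))"
      using M_mult[OF step(1) that(2)] by (rule V.span_base)
    from V.span_add[OF V.span_scale[OF this, of c] step(2)]
    show ?case by (simp add: algebra_simps)
  qed
  have span_mult: "a * b \<in> V.span (M (D + D'))" if "a \<in> V.span (M D)" "b \<in> V.span (M D')" for a b D D'
    using that(2)
  proof (induction rule: V.span_induct_alt)
    case base
    show ?case using V.span_zero by simp
  next
    case (step c u w)
    from V.span_add[OF V.span_scale[OF mult1[OF that(1) step(1)], of c] step(2)]
    show ?case by (simp add: algebra_simps)
  qed
  have one: "1 \<in> V.span (M D)" for D
    using M_I[of "\<lambda>_. 0" D] by (simp add: V.span_base)
  have qp: "\<exists>D. f x \<in> V.span (M D)" if "qpoly I f" for f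
    using that
  proof (induction rule: qpoly.induct)
    case (const c)
    show ?case using V.span_scale[OF one, of c] by auto
  next
    case (var i)
    have "(\<Prod>i'\<in>I. x i' ^ (if i' = i then 1 else 0)) \<in> M 1"
      by (rule M_I) auto
    moreover have "(\<Prod>i'\<in>I. x i' ^ (if i' = i then 1 else 0)) = (\<Prod>i'\<in>I. if i' = i then x i' else 1)"
      by (intro prod.cong) auto
    ultimately have "x i \<in> M 1" using var I by simp
    then show ?case using V.span_base by blast
  next
    case (add f g)
    then obtain D D' where "f x \<in> V.span (M D)" "g x \<in> V.span (M D')" by blast
    then have "f x \<in> V.span (M (max D D'))" "g x \<in> V.span (M (max D D'))"
      using M_mono[of D "max D D'"] M_mono[of D' "max D D'"] by auto
    then show ?case using V.span_add by blast
  next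
    case (mult f g)
    then show ?case using span_mult by blast
  qed
  have "\<exists>D. y j \<in> V.span (M D)" if "j \<in> C" for j
    using y[OF that] qp by metis
  then obtain d where d: "\<And>j. j \<in> C \<Longrightarrow> y j \<in> V.span (M (d j))" by metis
  have pow: "y j ^ e \<in> V.span (M (e * d j))" if "j \<in> C" for j e
  proof (induction e)
    case (Suc e)
    from span_mult[OF d[OF that] Suc] show ?case by simp
  qed (simp add: one)
  have prod: "(\<Prod>j\<in>S. y j ^ e j) \<in> V.span (M (\<Sum>j\<in>S. e j * d j))" if "S \<subseteq> C" for S e
    using finite_subset[OF that C] that
  proof (induction S)
    case (insert j S)
    then show ?case using span_mult[OF pow[of j "e j"]] by simp
  qed (simp add: one)
  \<comment> \<open>A factor \<open>y j ^ e j\<close> with \<open>e j \<le> k\<close> raises the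
    exponents in \<open>x\<close> by at most \<open>k * d j\<close>, so \<open>k * D\<close> bounds
    them for every monomial indexed by \<open>E\<close>.\<close>
  define D where "D = (\<Sum>j\<in>C. d j)"
  have main: "Suc k ^ card C \<le> Suc (k * D) ^ card I" for k
  proof -
    define E where "E = C \<rightarrow>\<^sub>E {..k}"
    define Y where "Y e = (\<Prod>j\<in>C. y j ^ e j)" for e :: "'j \<Rightarrow> nat"
    have finE: "finite E" unfolding E_def by (intro finite_PiE C) auto
    have indepE: "c e = 0" if "(\<Sum>e\<in>E. of_rat (c e) * Y e) = 0" "e \<in> E" for c e
    proof -
      have "qpoly C (\<lambda>y. \<Sum>e\<in>E. of_rat (c e) * (\<Prod>j\<in>C. y j ^ e j))"
        by (intro qpoly_sum qpoly.mult qpoly.const qpoly_prod qpoly_power qpoly.var)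
      from alg_indepD[OF indep this] that(1)
      have zero: "(\<Sum>e\<in>E. of_rat (c e) * (\<Prod>j\<in>C. y j ^ e j)) = 0" for y :: "'j \<Rightarrow> real"
        by (simp add: Y_def)
      have "real_of_rat (c e) = 0"
      proof (rule poly_function_eq_0_imp_coeff_0[OF C finE _ zero \<open>e \<in> E\<close>])
        fix m m' assume "m \<in> E" "m' \<in> E" "\<And>i. i \<in> C \<Longrightarrow> m i = m' i"
        then show "m = m'" unfolding E_def by (intro PiE_ext)
      qed
      then show ?thesis by simp
    qed
    \<comment> \<open>If two exponent vectors gave the same real, the coefficients \<open>1\<close>
      and \<open>-1\<close> would form a relation. So no monomial is lost when \<open>E\<close> is
      replaced by its image under \<open>Y\<close>.\<close>
    have injY: "inj_on Y E"
    proof (intro inj_onI, rule ccontr)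
      fix e e' assume e: "e \<in> E" "e' \<in> E" "Y e = Y e'" "e \<noteq> e'"
      define c :: "('j \<Rightarrow> nat) \<Rightarrow> rat" where "c a = (if a = e then 1 else if a = e' then -1 else 0)" for a
      have "(\<Sum>a\<in>E. of_rat (c a) * Y a) = (\<Sum>a\<in>{e, e'}. of_rat (c a) * Y a)"
        using e finE by (intro sum.mono_neutral_right) (auto simp: c_def)
      also have "\<dots> = 0" using e by (simp add: c_def)
      finally show False using indepE[of c e] e(1) by (simp add: c_def)
    qed
    have "V.independent (Y ` E)"
    proof
      assume "V.dependent (Y ` E)"
      then obtain u v where uv: "v \<in> Y ` E" "u v \<noteq> 0" "(\<Sum>v\<in>Y ` E. of_rat (u v) * v) = 0"
        using V.dependent_finite finE by blast
      then have "(\<Sum>e\<in>E. of_rat (u (Y e)) * Y e) = 0"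
        using injY by (simp add: sum.reindex)
      from indepE[OF this] uv(1,2) show False by auto
    qed
    moreover have "Y ` E \<subseteq> V.span (M (k * D))"
    proof
      fix a assume "a \<in> Y ` E"
      then obtain e where e: "e \<in> E" "a = Y e" by blast
      have "(\<Sum>j\<in>C. e j * d j) \<le> (\<Sum>j\<in>C. k * d j)"
        using e(1) by (intro sum_mono mult_right_mono) (auto simp: E_def dest: PiE_mem)
      then have "(\<Sum>j\<in>C. e j * d j) \<le> k * D" by (simp add: D_def sum_distrib_left)
      from subsetD[OF M_mono[OF this] prod[OF order_refl]] e(2)
      show "a \<in> V.span (M (k * D))" by (simp add: Y_def)
    qed
    ultimately have "card (Y ` E) \<le> card (M (k * D))"
      using V.independent_span_bound[OF finM] by blast
    then have "card E \<le> Suc (k * D) ^ card I"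
      using card_image[OF injY] cardM[of "k * D"] by linarith
    then show ?thesis using C by (simp add: E_def card_PiE)
  qed
  \<comment> \<open>Chosen so that the upper bound \<open>(Suc D * Suc k) ^ card I\<close> equals
    \<open>k * Suc k ^ card I\<close>, just below the \<open>Suc k * Suc k ^ card I\<close> that
    \<open>card C > card I\<close> forces from the other side.\<close>
  define k where "k = Suc D ^ card I"
  have "Suc k * Suc k ^ card I \<le> Suc k ^ card C"
    using less power_increasing[of "Suc (card I)" "card C" "Suc k"] by simp
  also have "\<dots> \<le> Suc (k * D) ^ card I" by (rule main)
  also have "\<dots> \<le> (Suc D * Suc k) ^ card I" by (intro power_mono) auto
  also have "\<dots> = k * Suc k ^ card I" by (simp add: k_def power_mult_distrib del: power_Suc mult_Suc mult_Suc_right)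
  finally show False by simp
qed

subsection \<open>Local determinacy implies algebraicity\<close>

text \<open>On \<open>W\<close> the values of \<open>G\<close> determine the coordinates in
  \<open>I\<close>, so they embed an open piece of \<open>card I\<close>-dimensional space into a
  space of no larger dimension. By invariance of domain the image is open, so the value at
  \<open>j0\<close> can be changed while the others stay fixed.\<close>

lemma vary_one_coordinate:
  fixes G :: "('i \<Rightarrow> real) \<Rightarrow> 'j \<Rightarrow> real"
  assumes I: "finite I" and J: "finite J" "card J \<le> card I"
    and W: "open W" "x0 \<in> W"
    and cont: "\<And>j. j \<in> J \<Longrightarrow> continuous_on UNIV (\<lambda>x. G x j)"
    and inj: "\<And>x x' i. x \<in> W \<Longrightarrow> x' \<in> W \<Longrightarrow> (\<And>j. j \<in> J \<Longrightarrow> G x j = G x' j) \<Longrightarrow> i \<in> I \<Longrightarrow> x i = x' i"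
    and j0: "j0 \<in> J"
  shows "\<exists>x\<in>W. (\<forall>j\<in>J - {j0}. G x j = G x0 j) \<and> G x j0 \<noteq> G x0 j0"
proof -
  define N where "N = card I"
  obtain h where h: "bij_betw h {..<N} I"
    using ex_bij_betw_nat_finite[OF I] by (auto simp: atLeast0LessThan N_def)
  obtain g where g: "bij_betw g {..<card J} J"
    using ex_bij_betw_nat_finite[OF J(1)] by (auto simp: atLeast0LessThan)
  define h' where "h' = inv_into {..<N} h"
  have h'h: "h' (h k) = k" if "k < N" for k
    using h that by (simp add: h'_def bij_betw_def)
  have hI: "h k \<in> I" if "k < N" for k using h that by (auto simp: bij_betw_def)
  have h'I: "h' i < N" "h (h' i) = i" if "i \<in> I" for i
    using bij_betw_inv_into_right[OF h that] bij_betw_inv_into[OF h] that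
    by (auto simp: h'_def bij_betw_def)
  have gJ: "g k \<in> J" if "k < card J" for k using g that by (auto simp: bij_betw_def)
  have gsurj: "\<exists>k<card J. j = g k" if "j \<in> J" for j
    using bij_betw_imp_surj_on[OF g] that by blast
  \<comment> \<open>Coordinates outside \<open>I\<close> are frozen at \<open>x0\<close>, and those
    in \<open>I\<close> are numbered, because \<open>Euclidean_space N\<close> consists of sequences
    that vanish from index \<open>N\<close> on.\<close>
  define \<Phi> where "\<Phi> z = (\<lambda>i. if i \<in> I then z (h' i) else x0 i)" for z :: "nat \<Rightarrow> real"
  \<comment> \<open>If \<open>J\<close> has fewer than \<open>N\<close> elements, zeros fill the
    remaining slots, so that source and target have the same dimension.\<close>
  define \<Psi> where "\<Psi> z = (\<lambda>k. if k < card J then G (\<Phi> z) (g k) else 0)" for z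
  have cont\<Phi>: "continuous_on UNIV \<Phi>"
    unfolding \<Phi>_def
  proof (rule continuous_on_coordinatewise_then_product)
    show "continuous_on UNIV (\<lambda>z::nat \<Rightarrow> real. if i \<in> I then z (h' i) else x0 i)" for i
      by (cases "i \<in> I") (auto intro: continuous_on_product_coordinates)
  qed
  have cont\<Psi>: "continuous_on UNIV \<Psi>"
    unfolding \<Psi>_def
  proof (rule continuous_on_coordinatewise_then_product)
    show "continuous_on UNIV (\<lambda>z. if k < card J then G (\<Phi> z) (g k) else 0)" for k
      by (cases "k < card J") (auto intro!: continuous_on_compose2[OF cont cont\<Phi>] gJ)
  qed
  define S :: "(nat \<Rightarrow> real) set" where "S = {z. \<forall>i\<ge>N. z i = 0}"
  have E: "Euclidean_space N = subtopology euclidean S"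
    by (simp add: Euclidean_space_def S_def euclidean_product_topology)
  define U where "U = \<Phi> -` W \<inter> S"
  have openU: "openin (Euclidean_space N) U"
    unfolding E U_def openin_subtopology
    using open_vimage[OF W(1) cont\<Phi>] by auto
  have "\<Psi> z \<in> S" for z using J(2) by (auto simp: \<Psi>_def S_def N_def)
  then have cm: "continuous_map (subtopology (Euclidean_space N) U) (Euclidean_space N) \<Psi>"
    unfolding E using cont\<Psi>
    by (intro continuous_map_into_subtopology continuous_map_from_subtopology)
      (auto simp: continuous_map_iff_continuous2)
  have inj\<Psi>: "inj_on \<Psi> U"
  proof (intro inj_onI ext)
    fix z z' k assume z: "z \<in> U" "z' \<in> U" "\<Psi> z = \<Psi> z'"
    have "G (\<Phi> z) j = G (\<Phi> z') j" if "j \<in> J" for j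
    proof -
      obtain l where "l < card J" "j = g l" using gsurj \<open>j \<in> J\<close> by blast
      then show ?thesis using fun_cong[OF z(3), of l] by (simp add: \<Psi>_def)
    qed
    then have "\<Phi> z i = \<Phi> z' i" if "i \<in> I" for i
      using inj[of "\<Phi> z" "\<Phi> z'"] z that by (auto simp: U_def)
    from this[of "h k"] show "z k = z' k"
      using z by (cases "k < N") (auto simp: \<Phi>_def hI h'h U_def S_def)
  qed
  have "openin (Euclidean_space N) (\<Psi> ` U)"
    by (rule invariance_of_domain_Euclidean_space[OF openU cm inj\<Psi>])
  then obtain T where T: "open T" "\<Psi> ` U = T \<inter> S"
    unfolding E openin_subtopology by auto
  define z0 where "z0 = (\<lambda>k. if k < N then x0 (h k) else 0)"
  have \<Phi>0: "\<Phi> z0 = x0" by (auto simp: \<Phi>_def z0_def h'I)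
  have "z0 \<in> S" by (simp add: S_def z0_def)
  then have "z0 \<in> U" using W(2) \<Phi>0 by (simp add: U_def)
  then have y0: "\<Psi> z0 \<in> T \<inter> S" using T(2) by blast
  obtain k0 where k0: "k0 < card J" "j0 = g k0" using gsurj j0 by blast
  define c where "c t = (\<Psi> z0)(k0 := t)" for t
  have "continuous_on UNIV c"
    unfolding c_def fun_upd_def
  proof (rule continuous_on_coordinatewise_then_product)
    show "continuous_on UNIV (\<lambda>t. if k = k0 then t else \<Psi> z0 k)" for k
      by (cases "k = k0") auto
  qed
  then have "open (c -` T)" using T(1) by (rule open_vimage[rotated])
  moreover have "\<Psi> z0 k0 \<in> c -` T" using y0 by (simp add: c_def)
  ultimately obtain e where e: "e > 0" "ball (\<Psi> z0 k0) e \<subseteq> c -` T" by (meson openE)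
  have "\<Psi> z0 k0 + e / 2 \<in> c -` T" using e by (intro subsetD[OF e(2)]) (auto simp: dist_real_def)
  moreover have "c (\<Psi> z0 k0 + e / 2) \<in> S" using y0 k0(1) J(2) by (auto simp: c_def S_def N_def)
  ultimately obtain z where z: "z \<in> U" "\<Psi> z = c (\<Psi> z0 k0 + e / 2)" using T(2) by force
  have eq: "G (\<Phi> z) (g k) = c (\<Psi> z0 k0 + e / 2) k" if "k < card J" for k
    using fun_cong[OF z(2), of k] that by (simp add: \<Psi>_def)
  have "G (\<Phi> z) j = G x0 j" if j: "j \<in> J - {j0}" for j
  proof -
    obtain k where k: "k < card J" "j = g k" using gsurj j by blast
    then have "k \<noteq> k0" using j k0 by auto
    with eq[OF k(1)] k show ?thesis by (simp add: c_def \<Psi>_def \<Phi>0)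
  qed
  moreover have "G (\<Phi> z) j0 \<noteq> G x0 j0"
    using eq[OF k0(1)] k0 e(1) by (simp add: c_def \<Psi>_def \<Phi>0)
  ultimately show ?thesis using z(1) by (auto simp: U_def)
qed

lemma alg_indep_empty: "alg_indep {} y"
  unfolding alg_indep_def using qpoly_cong by (metis empty_iff)

text \<open>The prescribed \<open>B0\<close> matters below: a basis of \<open>F\<close> together
  with \<open>d\<close> has to survive inside a larger basis.\<close>

lemma transcendence_basis_between:
  assumes F: "finite F" and "B0 \<subseteq> F" "alg_indep B0 y"
  shows "\<exists>B. B0 \<subseteq> B \<and> B \<subseteq> F \<and> alg_indep B y \<and> (\<forall>f\<in>F. algebraic_over B y (y f))"
proof -
  define S where "S = {B. B0 \<subseteq> B \<and> B \<subseteq> F \<and> alg_indep B y}"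
  have "finite S" by (rule finite_subset[of _ "Pow F"]) (use F in \<open>auto simp: S_def\<close>)
  moreover have "S \<noteq> {}" using assms(2,3) by (auto simp: S_def)
  ultimately obtain B where B: "B \<in> S" and max: "\<forall>B'\<in>S. B \<subseteq> B' \<longrightarrow> B = B'"
    using finite_has_maximal by metis
  have "algebraic_over B y (y f)" if "f \<in> F" for f
  proof (cases "f \<in> B")
    case False
    have "insert f B \<notin> S" using max False by blast
    then have "\<not> alg_indep (insert f B) y"
      using B that by (auto simp: S_def)
    moreover have "alg_indep B y" using B by (simp add: S_def)
    ultimately show ?thesis by (intro algebraic_over_if_dependent)
  qed (rule algebraic_over_member)
  with B show ?thesis by (auto simp: S_def)
qed

text \<open>
  If \<open>d x0\<close> were transcendental over the values of \<open>F\<close>, one could extend a transcendence basis of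
  \<open>F\<close> together with \<open>d\<close> to a transcendence basis by coordinates. The latter is a local coordinate
  system, in which \<open>d\<close> can be moved without moving \<open>F\<close>.
\<close>

lemma locally_determined_imp_algebraic:
  fixes x0 :: "'i \<Rightarrow> real"
  assumes I: "finite I" and indep: "alg_indep I x0"
    and F: "finite F" "\<And>f. f \<in> F \<Longrightarrow> qpoly I f" and d: "qpoly I d"
    and U: "open U" "x0 \<in> U"
    and det: "\<And>x. x \<in> U \<Longrightarrow> (\<And>f. f \<in> F \<Longrightarrow> f x = f x0) \<Longrightarrow> d x = d x0"
  shows "algebraic_over F (\<lambda>f. f x0) (d x0)"
proof (rule ccontr)
  let ?ev = "\<lambda>f::('i \<Rightarrow> real) \<Rightarrow> real. f x0"
  assume nalg: "\<not> algebraic_over F ?ev (d x0)"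
  from transcendence_basis_between[OF F(1) empty_subsetI alg_indep_empty[of ?ev]]
  obtain B where B: "B \<subseteq> F" "alg_indep B ?ev" "\<And>f. f \<in> F \<Longrightarrow> algebraic_over B ?ev (?ev f)"
    by auto
  have dB: "\<not> algebraic_over B ?ev (d x0)" using nalg B(1) algebraic_over_mono by blast
  then have "alg_indep (insert d B) ?ev" using algebraic_over_if_dependent[OF B(2)] by blast
  have "d \<notin> B" using dB algebraic_over_member[of d B ?ev] by blast
  define X where "X = (\<lambda>i (x::'i \<Rightarrow> real). x i) ` I"
  have "finite (insert d B \<union> X)" using I F(1) B(1) finite_subset by (auto simp: X_def)
  from transcendence_basis_between[OF this Un_upper1 \<open>alg_indep (insert d B) ?ev\<close>]
  obtain C where C: "insert d B \<subseteq> C" "C \<subseteq> insert d B \<union> X" "alg_indep C ?ev"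
    "\<And>f. f \<in> insert d B \<union> X \<Longrightarrow> algebraic_over C ?ev (?ev f)"
    by auto
  have finC: "finite C" using C(2) \<open>finite (insert d B \<union> X)\<close> finite_subset by blast
  have qC: "qpoly I f" if "f \<in> C" for f
    using that C(2) B(1) F(2) d by (auto simp: X_def intro: qpoly.var)
  have qB: "qpoly I f" if "f \<in> B" for f using that B(1) F(2) by blast
  have card: "card C \<le> card I"
    using alg_indep_card_le[OF I finC C(3)] qC by blast
  have "\<exists>W. open W \<and> x0 \<in> W \<and> (\<forall>x\<in>W. \<forall>x'\<in>W. (\<forall>f\<in>C. f x = f x') \<longrightarrow> x i = x' i)" if "i \<in> I" for i
    using locally_determined[OF indep qC qpoly.var[OF that]] C(4)[of "\<lambda>x. x i"] that
    by (auto simp: X_def)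
  then obtain W where W: "\<And>i. i \<in> I \<Longrightarrow> open (W i)" "\<And>i. i \<in> I \<Longrightarrow> x0 \<in> W i"
    "\<And>i x x'. i \<in> I \<Longrightarrow> x \<in> W i \<Longrightarrow> x' \<in> W i \<Longrightarrow> (\<forall>f\<in>C. f x = f x') \<Longrightarrow> x i = x' i"
    by metis
  have "\<exists>W. open W \<and> x0 \<in> W \<and> (\<forall>x\<in>W. \<forall>x'\<in>W. (\<forall>f\<in>B. f x = f x') \<longrightarrow> g x = g x')" if "g \<in> F" for g
    using locally_determined[OF indep qB F(2)[OF that] B(3)[OF that]] by blast
  then obtain W' where W': "\<And>g. g \<in> F \<Longrightarrow> open (W' g)" "\<And>g. g \<in> F \<Longrightarrow> x0 \<in> W' g"
    "\<And>g x x'. g \<in> F \<Longrightarrow> x \<in> W' g \<Longrightarrow> x' \<in> W' g \<Longrightarrow> (\<forall>f\<in>B. f x = f x') \<Longrightarrow> g x = g x'"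
    by metis
  define V where "V = U \<inter> (\<Inter>i\<in>I. W i) \<inter> (\<Inter>g\<in>F. W' g)"
  have V: "open V" "x0 \<in> V"
    unfolding V_def using U W(1,2) W'(1,2) I F(1) by (auto intro!: open_Int open_INT)
  \<comment> \<open>Moving \<open>d\<close> alone leaves \<open>B\<close> fixed, and on
    \<open>V\<close> the values of \<open>B\<close> determine those of \<open>F\<close>; so
    \<open>F\<close> stays fixed as well, against \<open>det\<close>.\<close>
  have "\<exists>x\<in>V. (\<forall>f\<in>C - {d}. f x = f x0) \<and> d x \<noteq> d x0"
  proof (rule vary_one_coordinate[of I C V x0 "\<lambda>x f. f x" d])
    show "continuous_on UNIV (\<lambda>x. f x)" if "f \<in> C" for f
      using continuous_on_qpoly[OF qC[OF that]] by simp
    show "x i = x' i" if "x \<in> V" "x' \<in> V" "\<And>f. f \<in> C \<Longrightarrow> f x = f x'" "i \<in> I" for x x' i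
      using W(3)[of i x x'] that by (auto simp: V_def)
  qed (use I finC card V C(1) in auto)
  then obtain x where x: "x \<in> V" "\<And>f. f \<in> C - {d} \<Longrightarrow> f x = f x0" "d x \<noteq> d x0" by blast
  have "\<forall>f\<in>B. f x = f x0" using x(2) C(1) \<open>d \<notin> B\<close> by blast
  then have "g x = g x0" if "g \<in> F" for g
    using W'(3)[OF that, of x x0] x(1) V(2) that by (auto simp: V_def)
  then show False using det[of x] x(1,3) by (auto simp: V_def)
qed

text \<open>The relation found at \<open>x0\<close> is an identity, and a coefficient that is
  nonzero at \<open>x0\<close> cannot vanish at the independent point \<open>x1\<close>. So all
  values of \<open>d\<close> on the fibre through \<open>x1\<close>, near or far, are roots of one
  nonzero polynomial.\<close>

lemma finitely_many_values_if_algebraic: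
  assumes x0: "alg_indep I x0" and x1: "alg_indep I x1"
    and F: "\<And>f. f \<in> F \<Longrightarrow> qpoly I f" and d: "qpoly I d"
    and alg: "algebraic_over F (\<lambda>f. f x0) (d x0)"
  shows "finite {d x | x. \<forall>f\<in>F. f x = f x1}"
proof -
  obtain A where A: "qpoly_family F A" "A (\<lambda>f. f x0) \<noteq> 0" "poly (A (\<lambda>f. f x0)) (d x0) = 0"
    using alg unfolding algebraic_over_def by blast
  have root: "poly (A (\<lambda>f. f x)) (d x) = 0" for x
    using alg_indepD[OF x0 qpoly_poly_family[OF A(1) F d]] A(3) by blast
  have coeffA: "qpoly F (\<lambda>y. Polynomial.coeff (A y) k)" for k using A(1) by (simp add: qpoly_family_def)
  obtain k where k: "Polynomial.coeff (A (\<lambda>f. f x0)) k \<noteq> 0"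
    using A(2) by (auto simp: poly_eq_iff)
  have "qpoly I (\<lambda>x. Polynomial.coeff (A (\<lambda>f. f x)) k)"
    by (rule qpoly_compose[OF coeffA]) (rule F)
  from alg_indepD[OF x1 this, of x0] k have "A (\<lambda>f. f x1) \<noteq> 0" by auto
  then have "finite {t. poly (A (\<lambda>f. f x1)) t = 0}" by (rule poly_roots_finite)
  moreover have "{d x | x. \<forall>f\<in>F. f x = f x1} \<subseteq> {t. poly (A (\<lambda>f. f x1)) t = 0}"
  proof clarify
    fix x assume "\<forall>f\<in>F. f x = f x1"
    then have "A (\<lambda>f. f x) = A (\<lambda>f. f x1)"
      by (intro poly_eqI) (rule qpoly_cong[OF coeffA], simp)
    with root[of x] show "poly (A (\<lambda>f. f x1)) (d x) = 0" by simp
  qed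
  ultimately show ?thesis by (rule rev_finite_subset)
qed

subsection \<open>Avoiding countably many polynomials\<close>

text \<open>On the line from \<open>x\<close> to \<open>a\<close> the function is a univariate
  polynomial with infinitely many zeros.\<close>

lemma real_polynomial_function_zero_interior:
  fixes f :: "'a::real_normed_vector \<Rightarrow> real"
  assumes f: "real_polynomial_function f" and e: "e > 0" and zero: "\<And>y. y \<in> ball x e \<Longrightarrow> f y = 0"
  shows "f a = 0"
proof -
  define g where "g t = f (x + t *\<^sub>R (a - x))" for t :: real
  have "polynomial_function (\<lambda>t::real. x + t *\<^sub>R (a - x))"
    by (intro polynomial_function_add polynomial_function_const polynomial_function_bounded_linear
        bounded_linear_scaleR_left)
  then have "real_polynomial_function g"
    using real_polynomial_function_compose[OF _ f] by (simp add: g_def[abs_def] o_def)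
  then obtain c n where c: "g = (\<lambda>t. \<Sum>i\<le>n. c i * t ^ i)"
    using real_polynomial_function_imp_sum by blast
  \<comment> \<open>The \<open>1\<close> keeps the denominator positive when
    \<open>a = x\<close>.\<close>
  define d where "d = e / (norm (a - x) + 1)"
  have "d > 0" using e by (simp add: d_def add_nonneg_pos)
  have "g t = 0" if "0 < t" "t < d" for t
  proof -
    have "norm (t *\<^sub>R (a - x)) < e"
    proof -
      have "t * norm (a - x) \<le> t * (norm (a - x) + 1)" using that by simp
      also have "\<dots> < d * (norm (a - x) + 1)"
        using that by (intro mult_strict_right_mono) (auto simp: add_nonneg_pos)
      also have "\<dots> = e" unfolding d_def using norm_ge_zero[of "a - x"] by (simp add: field_simps add_nonneg_eq_0_iff)
      finally show ?thesis using that by simp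
    qed
    then show ?thesis unfolding g_def by (intro zero) (simp add: dist_norm)
  qed
  then have "{0<..<d} \<subseteq> {t. (\<Sum>i\<le>n. c i * t ^ i) = 0}" using c by auto
  then have "infinite {t. (\<Sum>i\<le>n. c i * t ^ i) = 0}"
    using \<open>d > 0\<close> infinite_Ioo finite_subset by blast
  then have "c i = 0" if "i \<le> n" for i
    using polyfun_finite_roots[of c n] that by blast
  then have "g 1 = 0" by (simp add: c)
  then show ?thesis by (simp add: g_def)
qed

lemma countable_polynomials_common_nonzero:
  fixes F :: "('a::euclidean_space \<Rightarrow> real) set"
  assumes "countable F" and poly: "\<And>f. f \<in> F \<Longrightarrow> real_polynomial_function f"
    and nz: "\<And>f. f \<in> F \<Longrightarrow> \<exists>x. f x \<noteq> 0"
  shows "\<exists>x. \<forall>f\<in>F. f x \<noteq> 0"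
proof -
  have *: "open {x. f x \<noteq> 0} \<and> closure {x. f x \<noteq> 0} = UNIV" if "f \<in> F" for f
  proof
    have "continuous_on UNIV f"
      using poly[OF that] by (simp add: continuous_on_polymonial_function real_polynomial_function_eq)
    then show "open {x. f x \<noteq> 0}"
      using open_Collect_neq[of f "\<lambda>_. 0"] by simp
    show "closure {x. f x \<noteq> 0} = UNIV"
    proof (rule ccontr)
      assume "closure {x. f x \<noteq> 0} \<noteq> UNIV"
      then obtain x where "x \<in> - closure {x. f x \<noteq> 0}" by blast
      then obtain e where e: "e > 0" "ball x e \<subseteq> - closure {x. f x \<noteq> 0}"
        using openE[of "- closure {x. f x \<noteq> 0}" x] by auto
      then have "f y = 0" if "y \<in> ball x e" for y
        using that closure_subset[of "{x. f x \<noteq> 0}"] by blast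
      then show False
        using real_polynomial_function_zero_interior[OF poly[OF that] e(1)] nz[OF that] by blast
    qed
  qed
  have "UNIV \<subseteq> closure (\<Inter> ((\<lambda>f. {x. f x \<noteq> 0}) ` F))"
    by (rule Baire) (use * assms(1) in auto)
  then have "\<Inter> ((\<lambda>f. {x. f x \<noteq> 0}) ` F) \<noteq> {}" by force
  then show ?thesis by auto
qed

text \<open>Fixing the coordinates in \<open>I\<close> at independent values must not turn a nonzero
  polynomial into zero. The variables of \<open>K\<close> are released one at a time: some
  coefficient with respect to the new variable is a nonzero polynomial in the others, and once it is
  nonzero at the point, a suitable value of the new variable exists.\<close>

lemma nonzero_on_fibre_over_alg_indep:
  assumes y: "alg_indep I y" and K: "finite K" "I \<inter> K = {}"
    and f: "qpoly (I \<union> K) f" and nz: "f x \<noteq> 0"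
  shows "\<exists>y'. (\<forall>i. i \<notin> K \<longrightarrow> y' i = y i) \<and> f y' \<noteq> 0"
  using K f nz
proof (induction K arbitrary: f)
  case empty
  then have "f y \<noteq> 0" using alg_indepD[OF y, of f x] by auto
  then show ?case by blast
next
  case (insert i K)
  have "qpoly (insert i (I \<union> K)) f" "i \<notin> I \<union> K" using insert.prems insert.hyps by auto
  from qpoly_as_poly[OF this]
  obtain A where A: "qpoly_family (I \<union> K) A" "\<forall>x t. f (x(i := t)) = poly (A x) t" by blast
  have "poly (A x) (x i) \<noteq> 0" using A(2)[rule_format, of x "x i"] insert.prems(3) by simp
  then have "A x \<noteq> 0" by auto
  then obtain k where k: "Polynomial.coeff (A x) k \<noteq> 0" by (auto simp: poly_eq_iff)
  have disj: "I \<inter> K = {}" using insert.prems(1) by blast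
  have "qpoly (I \<union> K) (\<lambda>x. Polynomial.coeff (A x) k)" using A(1) by (simp add: qpoly_family_def)
  from insert.IH[OF disj this k]
  obtain y' where y': "\<forall>i. i \<notin> K \<longrightarrow> y' i = y i" "Polynomial.coeff (A y') k \<noteq> 0" by blast
  then have "A y' \<noteq> 0" by auto
  then obtain t where "poly (A y') t \<noteq> 0" using poly_all_0_iff_0 by blast
  then have "f (y'(i := t)) \<noteq> 0" using A(2) by metis
  moreover have "\<forall>j. j \<notin> insert i K \<longrightarrow> (y'(i := t)) j = y j" using y'(1) by simp
  ultimately show ?case by blast
qed

lemma countable_qpoly:
  fixes I :: "'i set"
  assumes "countable I"
  shows "countable {f. qpoly I f}"
proof -
  define base where "base = range (\<lambda>c (x::'i \<Rightarrow> real). real_of_rat c) \<union> (\<lambda>i x. x i) ` I"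
  define step where "step S = S \<union> (\<lambda>(f, g) x. f x + g x) ` (S \<times> S) \<union> (\<lambda>(f, g) x. f x * g x) ` (S \<times> S)"
    for S :: "(('i \<Rightarrow> real) \<Rightarrow> real) set"
  define stage where "stage n = (step ^^ n) base" for n
  have "countable (stage n)" for n
  proof (induction n)
    case 0
    then show ?case using assms by (auto simp: stage_def base_def)
  next
    case (Suc n)
    then show ?case by (simp add: stage_def) (simp add: step_def)
  qed
  then have "countable (\<Union>n. stage n)" by simp
  moreover have mono: "stage m \<subseteq> stage n" if "m \<le> n" for m n
    using that by (induction n rule: dec_induct) (auto simp: stage_def step_def)
  have "\<exists>n. f \<in> stage n" if "qpoly I f" for f
    using that
  proof (induction rule: qpoly.induct)
    case (const c)
    show ?case by (rule exI[of _ 0]) (auto simp: stage_def base_def)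
  next
    case (var i)
    then show ?case by (intro exI[of _ 0]) (auto simp: stage_def base_def)
  next
    case (add f g)
    then obtain m n where "f \<in> stage m" "g \<in> stage n" by blast
    then have "f \<in> stage (max m n)" "g \<in> stage (max m n)" using mono[of m "max m n"] mono[of n "max m n"] by auto
    then have "(\<lambda>x. f x + g x) \<in> stage (Suc (max m n))"
      by (force simp: stage_def step_def)
    then show ?case by blast
  next
    case (mult f g)
    then obtain m n where "f \<in> stage m" "g \<in> stage n" by blast
    then have "f \<in> stage (max m n)" "g \<in> stage (max m n)" using mono[of m "max m n"] mono[of n "max m n"] by auto
    then have "(\<lambda>x. f x * g x) \<in> stage (Suc (max m n))"
      by (force simp: stage_def step_def)
    then show ?case by blast
  qed
  then have "{f. qpoly I f} \<subseteq> (\<Union>n. stage n)" by blast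
  ultimately show ?thesis using countable_subset by blast
qed

section \<open>Realizations as points of coordinate space, and generic extensions\<close>

definition coords :: "('a \<Rightarrow> real ^ 'd) \<Rightarrow> 'a \<times> 'd \<Rightarrow> real" where
  "coords p = (\<lambda>(u, i). p u $ i)"

definition of_coords :: "('a \<times> 'd \<Rightarrow> real) \<Rightarrow> 'a \<Rightarrow> real ^ 'd" where
  "of_coords x u = (\<chi> i. x (u, i))"

lemma of_coords_coords [simp]: "of_coords (coords p) = p"
  by (auto simp: coords_def of_coords_def vec_eq_iff)

lemma generic_iff: "generic V p \<longleftrightarrow> alg_indep (V \<times> UNIV) (coords p)"
  by (simp add: generic_def alg_independent_rat_iff coords_def)

lemma real_polynomial_function_qpoly:
  fixes p :: "'a \<Rightarrow> real ^ 'd"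
  assumes "qpoly I f"
  shows "real_polynomial_function (\<lambda>x. f (coords (p(v := x))))"
  using assms
proof (induction rule: qpoly.induct)
  case (var i)
  obtain u k where i: "i = (u, k)" by fastforce
  show ?case
    by (cases "u = v")
      (auto simp: i coords_def intro!: real_polynomial_function.intros bounded_linear_vec_nth)
qed auto

lemma generic_extension_polynomials:
  fixes p :: "'a \<Rightarrow> real ^ 'd"
  assumes fin: "finite V" and "v \<in> V" and gen: "generic (V - {v}) p"
    and G: "countable G" "\<And>g. g \<in> G \<Longrightarrow> real_polynomial_function g" "\<And>g. g \<in> G \<Longrightarrow> \<exists>x. g x \<noteq> 0"
  shows "\<exists>x. generic V (p(v := x)) \<and> (\<forall>g\<in>G. g x \<noteq> 0)"
proof -
  let ?I = "(V - {v}) \<times> (UNIV :: 'd set)" and ?K = "{v} \<times> (UNIV :: 'd set)"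
  have VK: "V \<times> UNIV = ?I \<union> ?K" using assms(2) by auto
  define Q where "Q = {f. qpoly (V \<times> (UNIV :: 'd set)) f \<and> (\<exists>y. f y \<noteq> 0)}"
  \<comment> \<open>All coordinates but those of \<open>v\<close> are taken from \<open>p\<close>;
    their independence keeps each polynomial nonzero.\<close>
  define H where "H = (\<lambda>f x. f (coords (p(v := x)))) ` Q"
  have "countable (V \<times> (UNIV :: 'd set))" using fin by (intro countable_finite) simp
  then have "countable Q"
    unfolding Q_def by (rule countable_subset[OF _ countable_qpoly, rotated]) auto
  then have "countable (G \<union> H)" using G(1) by (simp add: H_def)
  moreover have "real_polynomial_function h" if "h \<in> G \<union> H" for h
    using that G(2) real_polynomial_function_qpoly by (auto simp: H_def Q_def)
  moreover have "\<exists>x. h x \<noteq> 0" if h: "h \<in> G \<union> H" for h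
  proof (cases "h \<in> G")
    case False
    then obtain f y where f: "qpoly (V \<times> UNIV) f" "f y \<noteq> 0" "h = (\<lambda>x. f (coords (p(v := x))))"
      using h False by (auto simp: H_def Q_def)
    have IK: "?I \<inter> ?K = {}" by auto
    have "finite ?K" by simp
    have "alg_indep ?I (coords p)" using gen by (simp add: generic_iff)
    from nonzero_on_fibre_over_alg_indep[where f = f and x = y, OF this \<open>finite ?K\<close> IK f(1)[unfolded VK] f(2)]
    obtain y' where y': "\<forall>i. i \<notin> ?K \<longrightarrow> y' i = coords p i" "f y' \<noteq> 0"
      by blast
    have "y' = coords (p(v := of_coords y' v))"
    proof
      fix i show "y' i = coords (p(v := of_coords y' v)) i"
        using y'(1)[rule_format, of i] by (cases i) (auto simp: coords_def of_coords_def)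
    qed
    then have "h (of_coords y' v) \<noteq> 0" using y'(2) f(3) by simp
    then show ?thesis by blast
  qed (use G(3) in blast)
  ultimately obtain x where x: "\<forall>h\<in>G \<union> H. h x \<noteq> 0"
    using countable_polynomials_common_nonzero by blast
  have "generic V (p(v := x))"
    unfolding generic_iff alg_indep_def
  proof (intro allI impI, rule ccontr)
    fix f y assume f: "qpoly (V \<times> (UNIV :: 'd set)) f" "f (coords (p(v := x))) = 0" "f y \<noteq> 0"
    then have "(\<lambda>x. f (coords (p(v := x)))) \<in> H" unfolding H_def Q_def by blast
    from bspec[OF x UnI2[OF this]] have "f (coords (p(v := x))) \<noteq> 0" .
    with f(2) show False by contradiction
  qed
  moreover have "\<forall>g\<in>G. g x \<noteq> 0" using x by simp
  ultimately show ?thesis by blast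
qed

subsection \<open>Distances in frameworks equivalent to a generic rigid one\<close>

text \<open>Squared, because the distance itself is not polynomial in the coordinates.\<close>

definition sqdist :: "'a \<Rightarrow> 'a \<Rightarrow> ('a \<times> 'd::finite \<Rightarrow> real) \<Rightarrow> real" where
  "sqdist u w x = (\<Sum>i\<in>UNIV. (x (u, i) - x (w, i)) ^ 2)"

lemma sqdist_eq_norm: "sqdist u w x = (norm (of_coords x u - of_coords x w)) ^ 2"
  by (simp add: sqdist_def of_coords_def norm_vec_def L2_set_def sum_nonneg)

lemma sqdist_eq_iff:
  "sqdist u w x = sqdist u w y \<longleftrightarrow>
    norm (of_coords x u - of_coords x w) = norm (of_coords y u - of_coords y w)"
  by (simp add: sqdist_eq_norm power2_eq_iff_nonneg)

lemma qpoly_sqdist: "u \<in> V \<Longrightarrow> w \<in> V \<Longrightarrow> qpoly (V \<times> UNIV) (sqdist u w)"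
  unfolding sqdist_def by (intro qpoly_sum qpoly_power qpoly_diff qpoly.var) auto

lemma rigid_generic_finitely_many_distances:
  fixes p :: "'a \<Rightarrow> real ^ 'd"
  assumes V: "finite V" and E: "\<And>u w. {u, w} \<in> E \<Longrightarrow> u \<in> V \<and> w \<in> V"
    and rigid: "rigid_graph TYPE('d) V E" and gen: "generic V p"
    and uw: "u \<in> V" "w \<in> V"
  shows "finite {norm (q u - q w) | q. equivalent_fw E p q}"
proof -
  obtain p0 :: "'a \<Rightarrow> real ^ 'd" where gen0: "generic V p0" and "rigid_fw V E p0"
    using rigid unfolding rigid_graph_def by blast
  then obtain U where U: "openin (product_topology (\<lambda>_. euclidean) V) U" "restrict p0 V \<in> U"
    and Ur: "\<And>q. q \<in> U \<Longrightarrow> equivalent_fw E p0 q \<Longrightarrow> congruent_fw V p0 q"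
    unfolding rigid_fw_def by blast
  let ?I = "V \<times> (UNIV :: 'd set)"
  define F where "F = (\<lambda>(u, w). sqdist u w :: ('a \<times> 'd \<Rightarrow> real) \<Rightarrow> real) ` {(u, w). {u, w} \<in> E}"
  have "{(u, w). {u, w} \<in> E} \<subseteq> V \<times> V" using E by auto
  then have "finite F" unfolding F_def using V by (meson finite_SigmaI finite_imageI finite_subset)
  have qF: "qpoly ?I f" if "f \<in> F" for f
    using that E by (auto simp: F_def intro!: qpoly_sqdist)
  have F_iff: "(\<forall>f\<in>F. f x = f y) \<longleftrightarrow> equivalent_fw E (of_coords x) (of_coords y)" for x y
    by (auto simp: F_def equivalent_fw_def sqdist_eq_iff)
  \<comment> \<open>The neighbourhood \<open>U\<close> lives in the product over \<open>V\<close>,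
    while polynomials live on all coordinate functions; \<open>r\<close> is the continuous passage
    between the two.\<close>
  define r where "r x = restrict (of_coords x) V" for x :: "'a \<times> 'd \<Rightarrow> real"
  have "continuous_on UNIV (\<lambda>x::'a \<times> 'd \<Rightarrow> real. of_coords x u)" for u
    unfolding of_coords_def
    by (intro continuous_on_vec_lambda continuous_on_product_coordinates)
  then have "continuous_map euclidean euclidean (\<lambda>x. r x u)" if "u \<in> V" for u
    using that by (simp add: r_def)
  then have "continuous_map euclidean (product_topology (\<lambda>_. euclidean) V) r"
    by (simp add: continuous_map_componentwise) (auto simp: r_def)
  then have "open (r -` U)"
    using openin_continuous_map_preimage[OF _ U(1), of euclidean r] by (simp add: vimage_def)
  have req: "equivalent_fw E (of_coords y) (r x) \<longleftrightarrow> equivalent_fw E (of_coords y) (of_coords x)" for x y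
    unfolding equivalent_fw_def r_def using E by (metis restrict_apply')
  have alg: "algebraic_over F (\<lambda>f. f (coords p0)) (sqdist u w (coords p0))"
  proof (rule locally_determined_imp_algebraic[of ?I _ F _ "r -` U"])
    show "finite ?I" using V by simp
    show "alg_indep ?I (coords p0)" using gen0 by (simp add: generic_iff)
    show "coords p0 \<in> r -` U" using U(2) by (simp add: r_def)
    fix x assume x: "x \<in> r -` U" "\<And>f. f \<in> F \<Longrightarrow> f x = f (coords p0)"
    have "\<forall>f\<in>F. f (coords p0) = f x" by (intro ballI x(2)[symmetric])
    then have "equivalent_fw E p0 (r x)"
      using F_iff[of "coords p0" x] req[of "coords p0" x] by simp
    then have "congruent_fw V p0 (r x)" using Ur x(1) by simp
    then have "norm (p0 u - p0 w) = norm (of_coords x u - of_coords x w)"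
      using uw by (simp add: congruent_fw_def r_def)
    then show "sqdist u w x = sqdist u w (coords p0)" by (simp add: sqdist_eq_iff)
  qed (use \<open>finite F\<close> qF \<open>open (r -` U)\<close> uw in \<open>auto intro: qpoly_sqdist\<close>)
  have "finite {sqdist u w x | x. \<forall>f\<in>F. f x = f (coords p)}"
    by (rule finitely_many_values_if_algebraic[of ?I "coords p0" "coords p" F "sqdist u w"])
      (use gen gen0 uw qF alg in \<open>auto simp: generic_iff intro: qpoly_sqdist\<close>)
  then have "finite (sqrt ` {sqdist u w x | x. \<forall>f\<in>F. f x = f (coords p)})" by (rule finite_imageI)
  moreover have "{norm (q u - q w) | q. equivalent_fw E p q} \<subseteq>
    sqrt ` {sqdist u w x | x. \<forall>f\<in>F. f x = f (coords p)}"
  proof clarify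
    fix q assume "equivalent_fw E p q"
    then have "equivalent_fw E q p" by (simp add: equivalent_fw_def)
    then have "\<forall>f\<in>F. f (coords q) = f (coords p)"
      using F_iff[of "coords q" "coords p"] by simp
    moreover have "norm (q u - q w) = sqrt (sqdist u w (coords q))"
      by (simp add: sqdist_eq_norm)
    ultimately show "norm (q u - q w) \<in> sqrt ` {sqdist u w x | x. \<forall>f\<in>F. f x = f (coords p)}"
      by blast
  qed
  ultimately show ?thesis by (rule rev_finite_subset)
qed

lemma rigid_generic_finitely_many_classes:
  fixes p :: "'a \<Rightarrow> real ^ 'd"
  assumes V: "finite V" and E: "\<And>u w. {u, w} \<in> E \<Longrightarrow> u \<in> V \<and> w \<in> V"
    and rigid: "rigid_graph TYPE('d) V E" and gen: "generic V p"
  shows "\<exists>R. finite R \<and> (\<forall>q. equivalent_fw E p q \<longrightarrow> (\<exists>q'\<in>R. congruent_fw V q q'))"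
proof -
  \<comment> \<open>The table of all distances, cut off outside pairs from \<open>V\<close>: equal
    tables mean congruent frameworks, and only finitely many tables occur.\<close>
  define D where "D q = restrict (\<lambda>(u, w). norm (q u - q w)) (V \<times> V)" for q :: "'a \<Rightarrow> real ^ 'd"
  let ?Q = "{q. equivalent_fw E p q}"
  have "D ` ?Q \<subseteq> (\<Pi>\<^sub>E (u, w)\<in>V \<times> V. {norm (q u - q w) | q. equivalent_fw E p q})"
    unfolding D_def image_subset_iff restrict_PiE_iff by auto
  moreover have "finite (\<Pi>\<^sub>E (u, w)\<in>V \<times> V. {norm (q u - q w) | q. equivalent_fw E p q})"
    using V rigid_generic_finitely_many_distances[OF V E rigid gen] by (intro finite_PiE) auto
  ultimately have "finite (D ` ?Q)" by (rule finite_subset)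
  then obtain R where R: "finite R" "D ` ?Q = D ` R"
    using finite_subset_image[of "D ` ?Q" D ?Q] by auto
  have "\<exists>q'\<in>R. congruent_fw V q q'" if q: "equivalent_fw E p q" for q
  proof -
    have "D q \<in> D ` R" using q R(2) by blast
    then obtain q' where "q' \<in> R" "D q = D q'" by auto
    moreover have "norm (q u - q w) = norm (q' u - q' w)" if "u \<in> V" "w \<in> V" for u w
      using fun_cong[OF \<open>D q = D q'\<close>, of "(u, w)"] that by (simp add: D_def)
    ultimately show ?thesis by (auto simp: congruent_fw_def)
  qed
  with R(1) show ?thesis by blast
qed

subsection \<open>Attaching a vertex\<close>

lemma inner_eq_norms: "a \<bullet> b = ((norm a)\<^sup>2 + (norm b)\<^sup>2 - (norm (a - b))\<^sup>2) / 2"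
  for a b :: "'a::real_inner"
  by (simp add: power2_norm_eq_inner inner_diff_left inner_diff_right inner_commute)

lemma congruent_fw_inner:
  assumes "congruent_fw S p q" "o' \<in> S" "u \<in> S" "w \<in> S"
  shows "(p u - p o') \<bullet> (p w - p o') = (q u - q o') \<bullet> (q w - q o')"
proof -
  have "norm (p u - p o') = norm (q u - q o')" "norm (p w - p o') = norm (q w - q o')"
    "norm ((p u - p o') - (p w - p o')) = norm ((q u - q o') - (q w - q o'))"
    using assms by (simp_all add: congruent_fw_def)
  then show ?thesis unfolding inner_eq_norms by simp
qed

lemma matrix_rows_mult_vec: "(\<chi> i. b (s i)) *v y = (\<chi> i. b (s i) \<bullet> y)"
  for b :: "'u \<Rightarrow> real ^ 'n"
  by (simp add: matrix_vector_mult_def vec_eq_iff inner_vec_def)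

lemma matrix_vec_cancel: "det A \<noteq> 0 \<Longrightarrow> A *v x = A *v y \<Longrightarrow> x = y"
  for A :: "real ^ 'n ^ 'n"
  using inj_matrix_vector_mult[of A] by (auto simp: invertible_det_nz inj_def)

text \<open>Equal Gram matrices give \<open>A ** transpose A = B ** transpose B\<close>, so
  \<open>A\<close> is invertible too and the \<open>M\<close> with \<open>A ** M = B\<close> is
  orthogonal; its transpose maps \<open>a (s i)\<close> to \<open>b (s i)\<close>. For other
  \<open>u\<close>, both \<open>T (a u)\<close> and \<open>b u\<close> have the same inner products
  with the basis \<open>b (s i)\<close>.\<close>

lemma gram_eq_imp_orthogonal:
  fixes a b :: "'u \<Rightarrow> real ^ 'n" and s :: "'n \<Rightarrow> 'u"
  assumes s: "\<And>i. s i \<in> S" and det: "det (\<chi> i. b (s i)) \<noteq> 0"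
    and gram: "\<And>u w. u \<in> S \<Longrightarrow> w \<in> S \<Longrightarrow> a u \<bullet> a w = b u \<bullet> b w"
  shows "\<exists>T. orthogonal_transformation T \<and> (\<forall>u\<in>S. T (a u) = b u)"
proof -
  define A where "A = (\<chi> i. a (s i))"
  define B where "B = (\<chi> i. b (s i))"
  have "A ** transpose A = B ** transpose B"
    using gram[OF s s]
    by (simp add: A_def B_def matrix_matrix_mult_def transpose_def vec_eq_iff inner_vec_def)
  then have "det A * det A = det B * det B" by (metis det_mul det_transpose)
  then have "det A \<noteq> 0" using det by (auto simp: B_def)
  then obtain A' where A': "A ** A' = mat 1" "A' ** A = mat 1"
    using invertible_det_nz[of A] by (auto simp: invertible_def)
  define M where "M = A' ** B"
  have AM: "A ** M = B" by (simp add: M_def matrix_mul_assoc A')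
  have "A ** (M ** transpose M) ** transpose A = A ** transpose A"
    using \<open>A ** transpose A = B ** transpose B\<close> AM[symmetric]
    by (simp add: matrix_transpose_mul matrix_mul_assoc)
  then have "A' ** (A ** (M ** transpose M) ** transpose A) ** transpose A'
    = A' ** (A ** transpose A) ** transpose A'" by simp
  moreover have "transpose A ** transpose A' = mat 1"
    by (simp add: A' matrix_transpose_mul[symmetric])
  ultimately have "M ** transpose M = mat 1"
    by (metis A'(2) matrix_mul_assoc matrix_mul_lid matrix_mul_rid)
  then have "orthogonal_matrix (transpose M)" by (simp add: orthogonal_matrix)
  define T where "T = (*v) (transpose M)"
  have orth: "orthogonal_transformation T"
    using \<open>orthogonal_matrix (transpose M)\<close>
    by (simp add: T_def orthogonal_transformation_matrix)
  have TA: "T (a (s i)) = b (s i)" for i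
  proof -
    have "transpose M *v a (s i) = row i (A ** M)"
      by (simp add: A_def row_def matrix_vector_mult_def matrix_matrix_mult_def transpose_def
          vec_eq_iff mult.commute)
    then show ?thesis by (simp add: T_def AM B_def row_def vec_lambda_eta)
  qed
  have "T (a u) = b u" if "u \<in> S" for u
  proof (rule matrix_vec_cancel[OF det])
    have "b (s i) \<bullet> T (a u) = b (s i) \<bullet> b u" for i
      using orth gram[OF s that, of i] TA[of i] by (metis orthogonal_transformation_def)
    then show "(\<chi> i. b (s i)) *v T (a u) = (\<chi> i. b (s i)) *v b u"
      by (simp add: matrix_rows_mult_vec)
  qed
  with orth show ?thesis by blast
qed

lemma congruent_fw_imp_orthogonal:
  fixes p q :: "'u \<Rightarrow> real ^ 'n" and s :: "'n \<Rightarrow> 'u"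
  assumes "congruent_fw S q p" "o' \<in> S" "\<And>i. s i \<in> S" "det (\<chi> i. p (s i) - p o') \<noteq> 0"
  shows "\<exists>T. orthogonal_transformation T \<and> (\<forall>u\<in>S. T (q u - q o') = p u - p o')"
  using assms congruent_fw_inner[OF assms(1,2)] by (intro gram_eq_imp_orthogonal[of s]) auto

text \<open>Trilateration: an orthogonal map takes \<open>q\<close> to \<open>p\<close> relative to
  the base point \<open>o'\<close>. The inner products of the two positions with a basis then agree
  by polarization, so the positions coincide and have equal distances to all of
  \<open>S\<close>.\<close>

lemma determined_by_neighbour_distances:
  fixes p q :: "'u \<Rightarrow> real ^ 'n" and s :: "'n \<Rightarrow> 'u"
  assumes cong: "congruent_fw S q p" and N: "o' \<in> N" "\<And>i. s i \<in> N" "N \<subseteq> S"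
    and det: "det (\<chi> i. p (s i) - p o') \<noteq> 0"
    and dist: "\<And>u. u \<in> N \<Longrightarrow> norm (y - q u) = norm (x - p u)" and "u \<in> S"
  shows "norm (y - q u) = norm (x - p u)"
proof -
  obtain T where T: "orthogonal_transformation T" "\<And>u. u \<in> S \<Longrightarrow> T (q u - q o') = p u - p o'"
    using congruent_fw_imp_orthogonal[OF cong _ _ det] N by blast
  have normT: "norm (T z) = norm z" for z using T(1) by (simp add: orthogonal_transformation)
  have "T (y - q o') = x - p o'"
  proof (rule matrix_vec_cancel[OF det])
    have "(p (s i) - p o') \<bullet> T (y - q o') = (p (s i) - p o') \<bullet> (x - p o')" for i
    proof -
      have "(p (s i) - p o') \<bullet> T (y - q o') = (q (s i) - q o') \<bullet> (y - q o')"
        using T(1) T(2)[of "s i"] N by (metis orthogonal_transformation_def subsetD)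
      also have "\<dots> = ((norm (q (s i) - q o'))\<^sup>2 + (norm (y - q o'))\<^sup>2 - (norm (y - q (s i)))\<^sup>2) / 2"
        by (simp add: inner_eq_norms norm_minus_commute)
      also have "\<dots> = ((norm (p (s i) - p o'))\<^sup>2 + (norm (x - p o'))\<^sup>2 - (norm (x - p (s i)))\<^sup>2) / 2"
        using dist[of o'] dist[of "s i"] N normT[of "q (s i) - q o'"] T(2)[of "s i"]
        by (simp add: subset_iff)
      also have "\<dots> = (p (s i) - p o') \<bullet> (x - p o')"
        by (simp add: inner_eq_norms norm_minus_commute)
      finally show ?thesis .
    qed
    then show "(\<chi> i. p (s i) - p o') *v T (y - q o') = (\<chi> i. p (s i) - p o') *v (x - p o')"
      using matrix_rows_mult_vec[of "\<lambda>u. p u - p o'" s] by simp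
  qed
  moreover have "T (y - q o') - T (q u - q o') = T (y - q u)"
    using T(1) by (simp add: orthogonal_transformation_def linear_diff[symmetric])
  ultimately have "T (y - q u) = x - p u" using T(2)[OF \<open>u \<in> S\<close>] by simp
  then show ?thesis using normT by metis
qed

text \<open>Suppose \<open>y\<close> sees \<open>q\<close> as \<open>x\<close> sees
  \<open>p\<close>. Then the inner products of \<open>y - q o'\<close> with the vectors
  \<open>q u - q o'\<close> are affine functions \<open>z u\<close> of \<open>x\<close>. If the
  vectors \<open>Q (s i)\<close> are dependent, the same dependency must hold between these
  functions. Otherwise they determine \<open>y\<close> up to an isometry as an affine function
  \<open>f x\<close>, and the remaining distances give the equations \<open>g0\<close> and
  \<open>g u\<close>. If all of these held identically, \<open>f\<close> would be an isometry
  carrying \<open>p\<close> to a translate of \<open>q'\<close> on \<open>N\<close>.\<close>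

lemma noncongruent_class_polynomial:
  fixes p q' :: "'u \<Rightarrow> real ^ 'n" and s :: "'n \<Rightarrow> 'u"
  assumes N: "o' \<in> N" "\<And>i. s i \<in> N" and det: "det (\<chi> i. p (s i) - p o') \<noteq> 0"
    and ncong: "\<not> congruent_fw N p q'"
  shows "\<exists>g. real_polynomial_function g \<and> (\<exists>x. g x \<noteq> 0) \<and>
    (\<forall>x y q. congruent_fw N q q' \<longrightarrow> (\<forall>u\<in>N. norm (y - q u) = norm (x - p u)) \<longrightarrow> g x = 0)"
proof -
  define P where "P u = p u - p o'" for u
  define Q where "Q u = q' u - q' o'" for u
  define c where "c u = ((norm (Q u))\<^sup>2 - (norm (P u))\<^sup>2) / 2" for u
  define z where "z u x = (x - p o') \<bullet> P u + c u" for u x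
  have inner_z: "(y - q o') \<bullet> (q u - q o') = z u x"
    if "congruent_fw N q q'" "\<forall>u\<in>N. norm (y - q u) = norm (x - p u)" "u \<in> N" for x y q u
  proof -
    have "norm (q u - q o') = norm (Q u)" using that N by (simp add: congruent_fw_def Q_def)
    moreover have "norm (y - q o') = norm (x - p o')" "norm (y - q u) = norm (x - p u)"
      using that N by auto
    ultimately have "(y - q o') \<bullet> (q u - q o') = ((norm (x - p o'))\<^sup>2 + (norm (Q u))\<^sup>2 - (norm (x - p u))\<^sup>2) / 2"
      by (simp add: inner_eq_norms)
    moreover have "(x - p o') \<bullet> P u = ((norm (x - p o'))\<^sup>2 + (norm (P u))\<^sup>2 - (norm (x - p u))\<^sup>2) / 2"
      by (simp add: inner_eq_norms P_def)
    ultimately show ?thesis by (simp add: z_def c_def field_simps)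
  qed
  have poly_inner: "real_polynomial_function (\<lambda>x. (x - p o') \<bullet> b)" for b
  proof -
    have "(\<lambda>x. (x - p o') \<bullet> b) = (\<lambda>x. x \<bullet> b - p o' \<bullet> b)" by (simp add: inner_diff_left)
    moreover have "real_polynomial_function (\<lambda>x. x \<bullet> b - p o' \<bullet> b)"
      by (intro real_polynomial_function_diff real_polynomial_function.intros bounded_linear_inner_left)
    ultimately show ?thesis by simp
  qed
  have poly_z: "real_polynomial_function (z u)" for u
    unfolding z_def by (intro real_polynomial_function.intros(3) real_polynomial_function.intros(2) poly_inner)
  define B where "B = (\<chi> i. Q (s i))"
  show ?thesis
  proof (cases "det B = 0")
    case True
    then have "\<not> invertible (transpose B)" by (simp add: invertible_det_nz)
    then obtain l where l: "transpose B *v l = 0" "l \<noteq> 0"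
      using matrix_left_invertible_ker[of "transpose B"] by (auto simp: invertible_left_inverse)
    have "transpose B *v l = (\<Sum>i\<in>UNIV. l $ i *\<^sub>R Q (s i))"
      by (simp add: matrix_vector_mult_def transpose_def B_def vec_eq_iff mult.commute)
    then have lQ: "(\<Sum>i\<in>UNIV. l $ i *\<^sub>R Q (s i)) = 0" using l by simp
    define g where "g x = (\<Sum>i\<in>UNIV. l $ i * z (s i) x)" for x
    have "real_polynomial_function g"
      unfolding g_def
      by (intro real_polynomial_function_sum real_polynomial_function.intros(4) real_polynomial_function.intros(2) poly_z) auto
    moreover have "\<exists>x. g x \<noteq> 0"
    proof (rule ccontr)
      assume g0: "\<nexists>x. g x \<noteq> 0"
      \<comment> \<open>Moving \<open>x\<close> from \<open>p o'\<close> by this \<open>w\<close>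
        changes \<open>g\<close> by \<open>w \<bullet> w\<close>; so if \<open>g\<close> vanishes,
        \<open>l\<close> is a dependency of the independent vectors \<open>P (s i)\<close> as
        well.\<close>
      define w where "w = (\<Sum>i\<in>UNIV. l $ i *\<^sub>R P (s i))"
      have "g (p o' + w) - g (p o') = w \<bullet> w"
        by (simp add: g_def z_def sum_subtractf[symmetric] algebra_simps)
          (simp add: w_def inner_sum_right)
      then have "w = 0" using g0 by simp
      have "transpose (\<chi> i. P (s i)) *v l = w"
        by (simp add: matrix_vector_mult_def transpose_def w_def vec_eq_iff mult.commute)
      then have "transpose (\<chi> i. P (s i)) *v l = transpose (\<chi> i. P (s i)) *v 0" using \<open>w = 0\<close> by simp
      then have "l = 0" by (rule matrix_vec_cancel[rotated]) (use det in \<open>simp add: det_transpose P_def\<close>)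
      with l(2) show False by simp
    qed
    moreover have "g x = 0" if H: "congruent_fw N q q'" "\<forall>u\<in>N. norm (y - q u) = norm (x - p u)" for x y q
    proof -
      let ?w = "\<Sum>i\<in>UNIV. l $ i *\<^sub>R (q (s i) - q o')"
      \<comment> \<open>\<open>q\<close> is only congruent to \<open>q'\<close>, but the length of a
        combination depends on inner products alone, so \<open>l\<close> annihilates the
        \<open>q (s i) - q o'\<close> too.\<close>
      have "?w \<bullet> ?w = (\<Sum>i\<in>UNIV. l $ i *\<^sub>R Q (s i)) \<bullet> (\<Sum>i\<in>UNIV. l $ i *\<^sub>R Q (s i))"
        unfolding inner_sum_left inner_sum_right inner_scaleR_left inner_scaleR_right Q_def
        by (simp add: congruent_fw_inner[OF H(1) N(1)] N(2))
      then have "?w = 0" using lQ by simp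
      have "g x = (y - q o') \<bullet> ?w"
        unfolding g_def inner_sum_right inner_scaleR_right
        using inner_z[OF H] N(2) by simp
      then show ?thesis using \<open>?w = 0\<close> by simp
    qed
    ultimately show ?thesis by blast
  next
    case False
    then obtain B' where B': "B ** B' = mat 1" "B' ** B = mat 1"
      using invertible_det_nz[of B] by (auto simp: invertible_def)
    define f where "f x = B' *v (\<chi> i. z (s i) x)" for x
    have f_nth: "f x $ k = (\<Sum>i\<in>UNIV. B' $ k $ i * z (s i) x)" for x k
      by (simp add: f_def matrix_vector_mult_def)
    have poly_f: "real_polynomial_function (\<lambda>x. f x $ k)" for k
      unfolding f_nth
      by (intro real_polynomial_function_sum real_polynomial_function.intros(4) real_polynomial_function.intros(2) poly_z) auto
    define g0 where "g0 x = f x \<bullet> f x - (x - p o') \<bullet> (x - p o')" for x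
    define g where "g u x = f x \<bullet> Q u - z u x" for u x
    have poly_g: "real_polynomial_function (g u)" for u
      unfolding g_def inner_vec_def inner_real_def
      by (intro real_polynomial_function_diff real_polynomial_function_sum real_polynomial_function.intros(4)
          real_polynomial_function.intros(2) poly_z poly_f) auto
    have "real_polynomial_function (\<lambda>x. (x - p o') $ k)" for k
      using poly_inner[of "axis k 1"] by (simp add: inner_axis)
    then have poly_g0: "real_polynomial_function g0"
      unfolding g0_def inner_vec_def inner_real_def
      by (intro real_polynomial_function_diff real_polynomial_function_sum real_polynomial_function.intros(4)
          real_polynomial_function.intros(2) poly_f) auto
    have vanish: "g0 x = 0 \<and> (\<forall>u\<in>N. g u x = 0)"
      if H: "congruent_fw N q q'" "\<forall>u\<in>N. norm (y - q u) = norm (x - p u)" for x y q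
    proof -
      obtain T where T: "orthogonal_transformation T" "\<And>u. u \<in> N \<Longrightarrow> T (q u - q o') = Q u"
        using congruent_fw_imp_orthogonal[where s = s, OF H(1) N] False unfolding B_def Q_def by blast
      have TQ: "T (y - q o') \<bullet> Q u = z u x" if "u \<in> N" for u
        using inner_z[OF H that] T(1) T(2)[OF that] by (metis orthogonal_transformation_def)
      have "B *v T (y - q o') = (\<chi> i. z (s i) x)"
        unfolding B_def matrix_rows_mult_vec using TQ N(2) by (simp add: inner_commute)
      then have f: "f x = T (y - q o')"
        unfolding f_def by (metis B'(2) matrix_vector_mul_assoc matrix_vector_mul_lid)
      have "f x \<bullet> f x = (norm (y - q o'))\<^sup>2"
        using T(1) f by (simp add: orthogonal_transformation_def power2_norm_eq_inner)
      also have "\<dots> = (x - p o') \<bullet> (x - p o')"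
        using H(2) N(1) by (simp add: power2_norm_eq_inner[symmetric])
      finally show ?thesis using TQ f by (simp add: g0_def g_def)
    qed
    have "(\<exists>x. g0 x \<noteq> 0) \<or> (\<exists>u\<in>N. \<exists>x. g u x \<noteq> 0)"
    proof (rule ccontr)
      assume "\<not> ?thesis"
      then have g0: "\<And>x. f x \<bullet> f x = (x - p o') \<bullet> (x - p o')" and g: "\<And>u x. u \<in> N \<Longrightarrow> f x \<bullet> Q u = z u x"
        by (auto simp: g0_def g_def)
      \<comment> \<open>At \<open>x = p o'\<close> the identities force \<open>f x = 0\<close> and
        then \<open>c u = 0\<close>, that is, \<open>P u\<close> and \<open>Q u\<close> have equal
        length; this makes \<open>f\<close> linear around \<open>p o'\<close>.\<close>
      have "f (p o') = 0" using g0[of "p o'"] by simp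
      then have c0: "c u = 0" if "u \<in> N" for u using g[OF that, of "p o'"] by (simp add: z_def)
      define L where "L = B' ** (\<chi> i. P (s i))"
      have L: "f (p o' + w) = L *v w" for w
      proof -
        have "(\<chi> i. z (s i) (p o' + w)) = (\<chi> i. P (s i)) *v w"
          using c0 N(2) by (simp add: z_def matrix_rows_mult_vec inner_commute)
        then show ?thesis by (simp add: f_def L_def matrix_vector_mul_assoc)
      qed
      have "norm (L *v w) = norm w" for w
        using g0[of "p o' + w"] by (simp add: L norm_eq_sqrt_inner)
      then have orth: "orthogonal_transformation ((*v) L)"
        by (simp add: orthogonal_transformation)
      \<comment> \<open>\<open>L\<close> is onto, so \<open>Q u\<close> has a preimage
        \<open>t\<close>; the identity for \<open>g u\<close> reads
        \<open>(L *v w) \<bullet> Q u = w \<bullet> P u\<close> for all \<open>w\<close>, which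
        identifies \<open>t\<close> with \<open>P u\<close>.\<close>
      have QL: "Q u = L *v P u" if "u \<in> N" for u
      proof -
        obtain t where t: "L *v t = Q u"
          using orthogonal_transformation_surj[OF orth] by (metis surjD)
        have "w \<bullet> t = w \<bullet> P u" for w
        proof -
          have "w \<bullet> t = (L *v w) \<bullet> (L *v t)" using orth by (simp add: orthogonal_transformation_def)
          also have "\<dots> = w \<bullet> P u"
            using g[OF that, of "p o' + w"] c0[OF that] by (simp add: L t z_def)
          finally show ?thesis .
        qed
        then have "t = P u" by (metis vector_eq_ldot)
        with t show ?thesis by simp
      qed
      have "congruent_fw N p q'"
        unfolding congruent_fw_def
      proof (intro ballI)
        fix u w assume "u \<in> N" "w \<in> N"
        have "q' u - q' w = Q u - Q w" by (simp add: Q_def)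
        also have "\<dots> = L *v (P u - P w)"
          by (simp add: QL \<open>u \<in> N\<close> \<open>w \<in> N\<close> matrix_vector_mult_diff_distrib)
        also have "P u - P w = p u - p w" by (simp add: P_def)
        finally show "norm (p u - p w) = norm (q' u - q' w)"
          using \<open>\<And>w. norm (L *v w) = norm w\<close> by simp
      qed
      with ncong show False by contradiction
    qed
    then show ?thesis
    proof (elim disjE bexE)
      assume "\<exists>x. g0 x \<noteq> 0"
      with poly_g0 vanish show ?thesis by (intro exI[of _ g0]) blast
    next
      fix u assume "u \<in> N" "\<exists>x. g u x \<noteq> 0"
      with poly_g[of u] vanish show ?thesis by (intro exI[of _ "g u"]) blast
    qed
  qed
qed

text \<open>The determinant is a rational polynomial in the coordinates, so at a generic point it
  vanishes only if it vanishes identically.\<close>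

lemma generic_imp_affinely_independent:
  fixes p :: "'a \<Rightarrow> real ^ 'n"
  assumes gen: "generic V p" and V: "o' \<in> V" "\<And>i. s i \<in> V" and s: "inj s" "o' \<notin> range s"
  shows "det (\<chi> i. p (s i) - p o') \<noteq> 0"
proof
  define f :: "('a \<times> 'n \<Rightarrow> real) \<Rightarrow> real" where "f x = det (\<chi> i j. x (s i, j) - x (o', j))" for x
  assume "det (\<chi> i. p (s i) - p o') = 0"
  moreover have "(\<chi> i. p (s i) - p o') = (\<chi> i j. coords p (s i, j) - coords p (o', j))"
    by (simp add: vec_eq_iff coords_def)
  ultimately have "f (coords p) = 0" by (simp add: f_def)
  moreover have "qpoly (V \<times> UNIV) f"
  proof -
    have "qpoly (V \<times> (UNIV :: 'n set)) (\<lambda>x. of_int k)" for k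
      using qpoly.const[of _ "of_int k"] by simp
    then show ?thesis
      unfolding f_def det_def using V
      by (auto intro!: qpoly_sum qpoly.mult qpoly_prod qpoly_diff qpoly.var)
  qed
  \<comment> \<open>The witness puts \<open>s i\<close> at the unit vector of index \<open>i\<close>
    and every other vertex at the origin, where the matrix is the identity.\<close>
  ultimately have "f (\<lambda>(u, j). if u = s j then 1 else 0) = 0"
    using gen alg_indepD unfolding generic_iff by blast
  moreover have "(\<chi> i j. (if s i = s j then 1 else 0) - (if o' = s j then 1 else 0)) = (mat 1 :: real ^ 'n ^ 'n)"
    using s by (auto simp: mat_def vec_eq_iff inj_eq)
  ultimately show False by (simp add: f_def)
qed

section \<open>Choice of the position of \<open>v\<close> and conclusion\<close>

theorem theorem4p2:
  fixes V :: "'a set" and E :: "'a set set" and v :: 'a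
    and p' :: "'a \<Rightarrow> real ^ 3"
  assumes "simple_graph V E"
    and "v \<in> V"
    and "vertex_degree E v > 3"
    and "rigid_graph TYPE(3) (V - {v}) (del_vertex_edges E v)"
    and "generic (V - {v}) p'"
    and "globally_rigid_fw (V - {v}) (del_vertex_edges E v \<union> complete_edges (nbrs E v)) p'"
  shows "\<exists>p :: 'a \<Rightarrow> real ^ 3.
           generic V p \<and> (\<forall>u \<in> V - {v}. p u = p' u) \<and> globally_rigid_fw V E p"
proof -
  define N where "N = nbrs E v"
  define E' where "E' = del_vertex_edges E v"
  have finV: "finite V" and edge: "\<And>e. e \<in> E \<Longrightarrow> e \<subseteq> V \<and> card e = 2"
    using assms(1) by (auto simp: simple_graph_def)
  have NV: "N \<subseteq> V - {v}"
    using edge by (fastforce simp: N_def nbrs_def)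
  have E'V: "u \<in> V - {v} \<and> w \<in> V - {v}" if "{u, w} \<in> E'" for u w
    using that edge by (auto simp: E'_def del_vertex_edges_def)
  have finN: "finite N" using NV finV finite_subset by blast
  have cardN: "card N > 3" using assms(3) by (simp add: vertex_degree_def N_def)
  then obtain o' where o': "o' \<in> N" by fastforce
  \<comment> \<open>Degree more than three supplies a base point \<open>o'\<close> and three further
    neighbours, the frame needed to pin down a point of space.\<close>
  have "card (UNIV :: 3 set) \<le> card (N - {o'})" using cardN o' finN by simp
  then obtain s :: "3 \<Rightarrow> 'a" where s: "range s \<subseteq> N - {o'}" "inj s"
    using card_le_inj[of "UNIV :: 3 set" "N - {o'}"] finN by auto
  have sN: "s i \<in> N" for i using s(1) by blast
  have det: "det (\<chi> i. p' (s i) - p' o') \<noteq> 0"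
    by (rule generic_imp_affinely_independent[OF assms(5)]) (use o' sN s NV in auto)
  have "finite (V - {v})" using finV by simp
  from rigid_generic_finitely_many_classes[OF this E'V assms(4)[folded E'_def] assms(5)]
  obtain R where R: "finite R" "\<forall>q. equivalent_fw E' p' q \<longrightarrow> (\<exists>q'\<in>R. congruent_fw (V - {v}) q q')"
    by blast
  have "\<exists>g. real_polynomial_function g \<and> (\<exists>x. g x \<noteq> 0) \<and>
    (\<forall>x y q. congruent_fw N q q' \<longrightarrow> (\<forall>u\<in>N. norm (y - q u) = norm (x - p' u)) \<longrightarrow> g x = 0)"
    if "\<not> congruent_fw N p' q'" for q'
    by (rule noncongruent_class_polynomial[where s = s, OF o' sN det that])
  then obtain g where g: "\<And>q'. \<not> congruent_fw N p' q' \<Longrightarrow> real_polynomial_function (g q')"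
    "\<And>q'. \<not> congruent_fw N p' q' \<Longrightarrow> \<exists>x. g q' x \<noteq> 0"
    "\<And>q' x y q. \<not> congruent_fw N p' q' \<Longrightarrow> congruent_fw N q q' \<Longrightarrow>
      (\<forall>u\<in>N. norm (y - q u) = norm (x - p' u)) \<Longrightarrow> g q' x = 0"
    by metis
  \<comment> \<open>Only classes that distort the neighbours are excluded here; for the others the
    global rigidity hypothesis takes over.\<close>
  define G where "G = g ` {q' \<in> R. \<not> congruent_fw N p' q'}"
  have "\<exists>x. generic V (p'(v := x)) \<and> (\<forall>f\<in>G. f x \<noteq> 0)"
    by (rule generic_extension_polynomials[OF finV assms(2,5)])
      (use R(1) g(1,2) in \<open>auto simp: G_def countable_finite\<close>)
  then obtain x where x: "generic V (p'(v := x))" "\<forall>f\<in>G. f x \<noteq> 0" by blast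
  define p where "p = p'(v := x)"
  have "congruent_fw V p q" if eq: "equivalent_fw E p q" for q
  proof -
    have eq': "equivalent_fw E' p' q"
      unfolding equivalent_fw_def
    proof (intro allI impI)
      fix u w assume uw: "{u, w} \<in> E'"
      then have "{u, w} \<in> E" by (simp add: E'_def del_vertex_edges_def)
      then have "norm (p u - p w) = norm (q u - q w)" using eq by (simp add: equivalent_fw_def)
      then show "norm (p' u - p' w) = norm (q u - q w)" using E'V[OF uw] by (simp add: p_def)
    qed
    have dist: "norm (q v - q u) = norm (x - p' u)" if "u \<in> N" for u
    proof -
      have "{u, v} \<in> E" using that by (simp add: N_def nbrs_def)
      then have "norm (p u - p v) = norm (q u - q v)" using eq by (simp add: equivalent_fw_def)
      moreover have "u \<noteq> v" using that NV by blast
      ultimately show ?thesis by (simp add: p_def norm_minus_commute)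
    qed
    obtain q' where q': "q' \<in> R" "congruent_fw (V - {v}) q q'" using R(2) eq' by blast
    have qq': "congruent_fw N q q'" using q'(2) NV by (auto simp: congruent_fw_def subset_iff)
    \<comment> \<open>Otherwise \<open>q v\<close> would be a \<open>y\<close> as in
      \<open>noncongruent_class_polynomial\<close>, and \<open>x\<close> would be a zero of
      \<open>g q'\<close>.\<close>
    have "congruent_fw N p' q'"
    proof (rule ccontr)
      assume n: "\<not> congruent_fw N p' q'"
      have "g q' x = 0" using g(3)[OF n qq'] dist by blast
      moreover have "g q' \<in> G" using n q'(1) by (auto simp: G_def)
      ultimately show False using x(2) by blast
    qed
    then have congN: "congruent_fw N p' q" using qq' by (simp add: congruent_fw_def)
    have "equivalent_fw (E' \<union> complete_edges N) p' q"
      unfolding equivalent_fw_def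
    proof (intro allI impI)
      fix u w assume "{u, w} \<in> E' \<union> complete_edges N"
      then consider "{u, w} \<in> E'" | "u \<in> N" "w \<in> N"
        by (auto simp: complete_edges_def doubleton_eq_iff)
      then show "norm (p' u - p' w) = norm (q u - q w)"
        by cases (use eq' congN in \<open>auto simp: equivalent_fw_def congruent_fw_def\<close>)
    qed
    then have cong: "congruent_fw (V - {v}) p' q"
      using assms(6) by (simp add: globally_rigid_fw_def E'_def N_def)
    then have cong': "congruent_fw (V - {v}) q p'" by (simp add: congruent_fw_def)
    have qv: "norm (q v - q u) = norm (x - p' u)" if "u \<in> V - {v}" for u
      by (rule determined_by_neighbour_distances[where s = s, OF cong' o' sN NV det dist that])
    show ?thesis
      unfolding congruent_fw_def
    proof (intro ballI)
      fix u w assume "u \<in> V" "w \<in> V"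
      then show "norm (p u - p w) = norm (q u - q w)"
        using cong qv[of u] qv[of w]
        by (cases "u = v"; cases "w = v") (auto simp: p_def congruent_fw_def norm_minus_commute)
    qed
  qed
  then have "globally_rigid_fw V E p" by (simp add: globally_rigid_fw_def)
  moreover have "generic V p" using x(1) by (simp add: p_def)
  moreover have "\<forall>u\<in>V - {v}. p u = p' u" by (simp add: p_def)
  ultimately show ?thesis by blast
qed

end
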